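(* Let $C\in\mathbb R^{n\times n}$ and let $f\in C(\mathbb R\times\mathbb R^n,\mathbb R^n)$ satisfy $f(t,0)=0$ for all $t\in\mathbb R$. Let $\alpha$ and $\beta$ be respectively the minimum and the maximum of the real parts of the eigenvalues of $C$, and let $m_\alpha$ (resp. $m_\beta$) be the maximum of the degrees of the elementary divisors of $C$ corresponding to eigenvalues with real part equal to $\alpha$ (resp. $\beta$). Assume that there is a nonnegative function $\eta$ on $\mathbb R_+=[0,\infty)$ such that: 1. $\|f(t,x_1)-f(t,x_2)\|\le\eta(t)\|x_1-x_2\|$ for all $(t,x_1),(t,x_2)\in\mathbb R_+\times\mathbb R^n$; 2. $\displaystyle\int_0^\infty t^{m_\beta+m_\alpha-2}e^{(\beta-\alpha)t}\eta(t)\,dt<\infty$; 3. $\displaystyle\lim_{t\to\infty}\int_t^\infty (s-t)^{m_\alpha-1}s^{m_\beta-1}e^{\alpha(t-s)}e^{\beta s}\eta(s)\,ds=0$. Then the systems $y'=Cy+f(t,y)$ and $x'=Cx$ are asymptotically equivalent.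
   Context: $\|\cdot\|$ is the Euclidean norm on $\mathbb R^n$. The degree of an elementary divisor of $C$ over $\mathbb C$ is the size of the corresponding Jordan block. Two systems are called asymptotically equivalent if there is a homeomorphism $x\leftrightarrow y$ between their sets of solutions such that corresponding solutions satisfy $x(t)-y(t)\to0$ as $t\to\infty$. Here solutions are considered on a half-line $[t_0,\infty)$ for some initial time $t_0\ge0$, and the set of solutions is topologized by identifying a solution with its value at $t_0$. *)

theory Defs
  imports
    "HOL-Analysis.Analysis"
    "Jordan_Normal_Form.Spectral_Radius"
    "Jordan_Normal_Form.Jordan_Normal_Form_Existence"
begin

(* The complexification of a real square matrix, as a matrix of the type on which eigenvalues and
   Jordan normal forms are defined. from_nat_into UNIV restricts to a bijection from {..<CARD('n)}
   to the index type; another enumeration gives a similar matrix, so the spectrum and the Jordan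
   blocks do not depend on this choice. *)
definition complex_mat :: "real^'n^'n \<Rightarrow> complex mat" where
  "complex_mat C = Matrix.mat CARD('n) CARD('n)
     (\<lambda>(i, j). complex_of_real
        (vec_nth (vec_nth C (from_nat_into (UNIV :: 'n set) i)) (from_nat_into (UNIV :: 'n set) j)))"

definition eigenvalue_re_parts :: "real^'n^'n \<Rightarrow> real set" where
  "eigenvalue_re_parts C = Re ` spectrum (complex_mat C)"

(* The Jordan normal form is unique only up to the order of the blocks, hence the quantifier
   over n_as, the list of pairs (block size, eigenvalue). *)
definition elementary_divisor_degrees :: "real^'n^'n \<Rightarrow> real \<Rightarrow> nat set" where
  "elementary_divisor_degrees C r =
     {k. \<exists>n_as z. jordan_nf (complex_mat C) n_as \<and> (k, z) \<in> set n_as \<and> Re z = r}"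

(* Solutions on the closed half-line, with the one-sided derivative at t0. Membership in
   extensional fixes the irrelevant values to the left of t0, so that two solutions are equal as
   elements of this set iff they agree on the half-line. *)
definition solutions ::
  "(real \<Rightarrow> 'a \<Rightarrow> 'a) \<Rightarrow> real \<Rightarrow> (real \<Rightarrow> 'a::real_normed_vector) set" where
  "solutions F t0 = {x \<in> extensional {t0..}.
     \<forall>t\<ge>t0. (x has_vector_derivative F t (x t)) (at t within {t0..})}"

definition solution_topology ::
  "(real \<Rightarrow> 'a \<Rightarrow> 'a) \<Rightarrow> real \<Rightarrow> (real \<Rightarrow> 'a::real_normed_vector) topology" where
  "solution_topology F t0 = pullback_topology (solutions F t0) (\<lambda>x. x t0) euclidean"

(* The injectivity conditions say that the identification of a solution with its value at t0,
   which defines the topology, is legitimate; with them, solution_topology is homeomorphic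
   to the set of values at t0 as a subspace of 'a. *)
definition asymptotically_equivalent ::
  "(real \<Rightarrow> 'a \<Rightarrow> 'a) \<Rightarrow> (real \<Rightarrow> 'a::real_normed_vector \<Rightarrow> 'a) \<Rightarrow> bool" where
  "asymptotically_equivalent F G \<longleftrightarrow>
     (\<exists>t0\<ge>0.
        inj_on (\<lambda>x. x t0) (solutions F t0) \<and>
        inj_on (\<lambda>x. x t0) (solutions G t0) \<and>
        (\<exists>h. homeomorphic_map (solution_topology F t0) (solution_topology G t0) h \<and>
             (\<forall>x\<in>solutions F t0. ((\<lambda>t. x t - h x t) \<longlongrightarrow> 0) at_top)))"

end

theory Submission
  imports Defs
begin

text \<open>
  Let \<open>\<Phi> t\<close> be the exponential of \<open>t C\<close>. The correspondence between the two systems sends a solution \<open>y\<close> of the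
  perturbed system to
  \<open>x t = y t + \<integral>\<^sub>t\<^sup>\<infinity> \<Phi> (t - s) (f s (y s)) ds\<close>.
  Differentiation shows that \<open>x\<close> solves the linear system. What has to be shown is that the integral exists,
  that the map is a homeomorphism, and that the integral tends to 0.

  The Jordan normal form bounds \<open>\<Phi> t\<close> by a multiple of \<open>(1 + t)^p exp (\<beta> t)\<close> for \<open>t \<ge> 0\<close> and of
  \<open>(1 - t)^q exp (\<alpha> t)\<close> for \<open>t < 0\<close>, where \<open>p\<close> and \<open>q\<close> are \<open>m\<^sub>\<beta> - 1\<close> and \<open>m\<^sub>\<alpha> - 1\<close> (\<open>flow_growth_bound\<close>).
  Solutions are measured in the supremum norm with weight \<open>w t = t^p exp (\<beta> t)\<close>. For \<open>s\<close> and \<open>t\<close> at least 1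
  the weighted kernel of the integral equation is bounded, whichever of \<open>s\<close> and \<open>t\<close> is larger, by a multiple of
  \<open>s^(p + q) exp ((\<beta> - \<alpha>) s) \<eta> s\<close> (\<open>growth_rate_weight_le\<close>). This density is integrable by the second
  hypothesis, so its integral over \<open>[t0, \<infinity>)\<close> is as small as desired for a late initial time \<open>t0\<close>. Both
  directions of integration are then contractions with constant \<open>1/2\<close>:

  \<^item> The forward integral equation, started at \<open>t0\<close>, shows that solutions of the perturbed system are
    bounded in the weighted norm, are determined by their value at \<open>t0\<close>, and depend on it in a Lipschitz
    way (\<open>solution_diff_le\<close>).
  \<^item> The backward integral equation can be solved for \<open>y\<close> when \<open>x\<close> is given (\<open>add_tail_surjective\<close>), and
    the solution depends on \<open>x\<close> in a Lipschitz way (\<open>solution_diff_le_linear_diff\<close>).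

  Finally, the third hypothesis makes \<open>x t - y t\<close> tend to 0. The flow contributes the factor \<open>(1 + s - t)^q\<close>
  instead of \<open>(s - t)^q\<close>, but \<open>1 + s - t = s - (t - 1)\<close>, so the integral in question is at most a constant times the
  integral of the hypothesis taken at \<open>t - 1\<close>.
\<close>

section \<open>Flows of linear systems\<close>

text \<open>\<open>\<Phi> t\<close> is the exponential of \<open>t A\<close>. It enters the perturbation argument only through its differential
  equation, its initial value and the fact that it commutes with \<open>A\<close>, so that it may be built in
  whatever way makes its growth visible.\<close>
locale linear_flow =
  fixes A :: "'a::euclidean_space \<Rightarrow>\<^sub>L 'a" and \<Phi> :: "real \<Rightarrow> 'a \<Rightarrow>\<^sub>L 'a"
  assumes flow_0: "\<Phi> 0 = id_blinfun"
    and flow_deriv: "\<And>t. (\<Phi> has_vector_derivative A o\<^sub>L \<Phi> t) (at t)"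
    and flow_commute: "\<And>t. A o\<^sub>L \<Phi> t = \<Phi> t o\<^sub>L A"
begin

lemma flow_deriv_within [derivative_intros]:
  "(\<Phi> has_vector_derivative A o\<^sub>L \<Phi> t) (at t within S)"
  by (rule has_vector_derivative_at_within[OF flow_deriv])

lemma flow_deriv_compose:
  assumes "(g has_vector_derivative g') (at t within S)"
  shows "((\<lambda>t. \<Phi> (g t)) has_vector_derivative g' *\<^sub>R (A o\<^sub>L \<Phi> (g t))) (at t within S)"
  using vector_diff_chain_within[OF assms, of \<Phi> "A o\<^sub>L \<Phi> (g t)"] flow_deriv_within
  by (simp add: o_def)

lemma continuous_flow [continuous_intros]:
  assumes "continuous_on S g"
  shows "continuous_on S (\<lambda>t. \<Phi> (g t))"
proof -
  have "isCont \<Phi> t" for t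
    using flow_deriv has_vector_derivative_continuous by blast
  then have "continuous_on UNIV \<Phi>"
    by (simp add: continuous_at_imp_continuous_on)
  then show ?thesis
    using assms by (rule continuous_on_compose2) auto
qed

text \<open>The derivative of \<open>\<Phi> (s + t - u) o\<^sub>L \<Phi> u\<close> in \<open>u\<close> vanishes because \<open>A\<close> commutes with \<open>\<Phi>\<close>;
  the two sides are its values at \<open>u = t\<close> and \<open>u = 0\<close>.\<close>
lemma flow_add: "\<Phi> (s + t) = \<Phi> s o\<^sub>L \<Phi> t"
proof -
  define G where "G u = \<Phi> (s + t - u) o\<^sub>L \<Phi> u" for u
  have inner: "((\<lambda>u. s + t - u) has_vector_derivative - 1) (at u)" for u
    by (auto intro!: derivative_eq_intros)
  have "(G has_vector_derivative 0) (at u)" for u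
  proof -
    have "(G has_vector_derivative (\<Phi> (s + t - u) o\<^sub>L (A o\<^sub>L \<Phi> u))
        + ((- 1) *\<^sub>R (A o\<^sub>L \<Phi> (s + t - u)) o\<^sub>L \<Phi> u)) (at u)"
      unfolding G_def
      by (rule bounded_bilinear.has_vector_derivative
          [OF bounded_bilinear_blinfun_compose flow_deriv_compose[OF inner] flow_deriv])
    moreover have "(\<Phi> (s + t - u) o\<^sub>L (A o\<^sub>L \<Phi> u))
        + ((- 1) *\<^sub>R (A o\<^sub>L \<Phi> (s + t - u)) o\<^sub>L \<Phi> u) = 0"
      unfolding flow_commute[of "s + t - u"]
      by (intro blinfun_eqI) (simp add: blinfun.bilinear_simps)
    ultimately show ?thesis by simp
  qed
  then obtain c where "\<And>u. G u = c"
    using has_vector_derivative_zero_constant[of UNIV G] by (metis UNIV_I convex_UNIV)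
  then have "G 0 = G t" by metis
  then have "\<Phi> (s + t) o\<^sub>L id_blinfun = \<Phi> s o\<^sub>L \<Phi> t"
    by (simp add: G_def flow_0)
  moreover have "\<Phi> (s + t) o\<^sub>L id_blinfun = \<Phi> (s + t)"
    by (intro blinfun_eqI) simp
  ultimately show ?thesis by simp
qed

lemma flow_add_apply: "blinfun_apply (\<Phi> s) (blinfun_apply (\<Phi> t) v) = blinfun_apply (\<Phi> (s + t)) v"
  by (simp add: flow_add)

lemma flow_0_apply [simp]: "blinfun_apply (\<Phi> 0) v = v"
  by (simp add: flow_0)

lemma flow_apply_deriv:
  assumes "(g has_vector_derivative g') (at t within S)"
  shows "((\<lambda>t. blinfun_apply (\<Phi> (t - a)) (g t)) has_vector_derivative
     A (\<Phi> (t - a) (g t)) + \<Phi> (t - a) g') (at t within S)"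
proof -
  have "((\<lambda>t. t - a) has_vector_derivative 1) (at t within S)"
    by (auto intro!: derivative_eq_intros)
  from bounded_bilinear.has_vector_derivative
      [OF bounded_bilinear_blinfun_apply flow_deriv_compose[OF this] assms]
  show ?thesis by (simp add: add.commute)
qed

lemma flow_commute_apply: "blinfun_apply A (\<Phi> t v) = \<Phi> t (A v)"
  using flow_commute[of t] by (metis blinfun_apply_blinfun_compose)

text \<open>The function \<open>s \<mapsto> \<Phi> (t - s) (y s)\<close> interpolates between \<open>\<Phi> (t - t0) (y t0)\<close> and \<open>y t\<close>, and
  its derivative is exactly the transported forcing term.\<close>
lemma variation_of_constants:
  assumes y: "\<And>t. t \<ge> t0 \<Longrightarrow> (y has_vector_derivative A (y t) + g t) (at t within {t0..})"
    and t: "t \<ge> t0"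
  shows "((\<lambda>s. \<Phi> (t - s) (g s)) has_integral y t - \<Phi> (t - t0) (y t0)) {t0..t}"
proof -
  have "((\<lambda>s. \<Phi> (t - s) (y s)) has_vector_derivative \<Phi> (t - s) (g s)) (at s within {t0..t})"
    if s: "s \<in> {t0..t}" for s
  proof -
    have inner: "((\<lambda>s. t - s) has_vector_derivative - 1) (at s within {t0..t})"
      by (auto intro!: derivative_eq_intros)
    have ys: "(y has_vector_derivative A (y s) + g s) (at s within {t0..t})"
      using y[of s] s by (auto intro: has_vector_derivative_within_subset)
    from bounded_bilinear.has_vector_derivative
      [OF bounded_bilinear_blinfun_apply flow_deriv_compose[OF inner] ys]
    show ?thesis by (simp add: blinfun.bilinear_simps flow_commute_apply)
  qed
  from fundamental_theorem_of_calculus[OF t this] show ?thesis by simp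
qed

end

section \<open>Small perturbations in a weighted norm\<close>

lemma integral_atLeast_split:
  fixes G :: "real \<Rightarrow> 'b::euclidean_space"
  assumes "G integrable_on {a..u}" "G integrable_on {u..}" "a \<le> u"
  shows "integral {a..} G = integral {a..u} G + integral {u..} G"
proof -
  have "(G has_integral integral {a..u} G + integral {u..} G) ({a..u} \<union> {u..})"
  proof (rule has_integral_Un)
    show "(G has_integral integral {a..u} G) {a..u}" "(G has_integral integral {u..} G) {u..}"
      using assms by (auto intro!: integrable_integral)
    have "{a..u} \<inter> {u..} \<subseteq> {u}" by auto
    then show "negligible ({a..u} \<inter> {u..})" using negligible_subset negligible_sing by blast
  qed
  moreover have "{a..u} \<union> {u..} = {a..}" using assms(3) by auto
  ultimately show ?thesis by (simp add: integral_unique)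
qed

text \<open>In a topology pulled back along an evaluation map, continuity need only be checked on values; the
  values actually taken may form any subset of the space.\<close>
lemma continuous_map_pullback_lipschitz:
  fixes e :: "'x \<Rightarrow> 'a::metric_space" and e' :: "'y \<Rightarrow> 'b::metric_space"
  assumes hXY: "\<And>x. x \<in> X \<Longrightarrow> h x \<in> Y"
    and lip: "\<And>x x'. \<lbrakk>x \<in> X; x' \<in> X\<rbrakk> \<Longrightarrow> dist (e' (h x)) (e' (h x')) \<le> K * dist (e x) (e x')"
  shows "continuous_map (pullback_topology X e euclidean) (pullback_topology Y e' euclidean) h"
  unfolding continuous_map_def
proof (intro conjI allI impI)
  show "h \<in> topspace (pullback_topology X e euclidean) \<rightarrow> topspace (pullback_topology Y e' euclidean)"
    using hXY by (auto simp: topspace_pullback_topology)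
  fix S assume "openin (pullback_topology Y e' euclidean) S"
  then obtain U where U: "open U" and S: "S = e' -` U \<inter> Y"
    by (auto simp: openin_pullback_topology)
  define V where "V = \<Union> {ball (e x) \<delta> | x \<delta>. x \<in> X \<and> (\<forall>x'\<in>X. dist (e x) (e x') < \<delta> \<longrightarrow> e' (h x') \<in> U)}"
  have "open V" unfolding V_def by auto
  moreover have "{x \<in> X. h x \<in> S} = e -` V \<inter> X"
  proof (intro equalityI subsetI)
    fix x assume "x \<in> {x \<in> X. h x \<in> S}"
    then have x: "x \<in> X" "e' (h x) \<in> U" using S by auto
    then obtain \<epsilon> where \<epsilon>: "\<epsilon> > 0" "ball (e' (h x)) \<epsilon> \<subseteq> U"
      using U open_contains_ball by blast
    define \<delta> where "\<delta> = \<epsilon> / (\<bar>K\<bar> + 1)"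
    have "\<delta> > 0" using \<epsilon> by (simp add: \<delta>_def)
    have "e' (h x') \<in> U" if "x' \<in> X" "dist (e x) (e x') < \<delta>" for x'
    proof -
      have "dist (e' (h x)) (e' (h x')) \<le> K * dist (e x) (e x')"
        using lip x that by blast
      also have "\<dots> \<le> (\<bar>K\<bar> + 1) * dist (e x) (e x')"
        by (intro mult_right_mono) auto
      also have "\<dots> < (\<bar>K\<bar> + 1) * \<delta>"
        using that by (intro mult_strict_left_mono) auto
      also have "\<dots> = \<epsilon>" by (simp add: \<delta>_def)
      finally show ?thesis using \<epsilon> by auto
    qed
    then have "e x \<in> V"
      unfolding V_def using x \<open>\<delta> > 0\<close> by (intro UnionI[of "ball (e x) \<delta>"]) auto
    then show "x \<in> e -` V \<inter> X" using x by auto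
  next
    fix x assume "x \<in> e -` V \<inter> X"
    then show "x \<in> {x \<in> X. h x \<in> S}" using S hXY by (auto simp: V_def)
  qed
  ultimately show "openin (pullback_topology X e euclidean)
      {x \<in> topspace (pullback_topology X e euclidean). h x \<in> S}"
    by (auto simp: openin_pullback_topology topspace_pullback_topology)
qed

text \<open>Solutions are measured against a weight \<open>w\<close>, which grows like the fastest solutions of the linear
  system. The perturbation enters through two majorants of the transported forcing term
  \<open>\<Phi> (t - s) (f s (y s))\<close>, where \<open>y\<close> is of size \<open>M w\<close>:

  \<^item> \<open>M * w t * \<theta> s\<close>, for \<open>s\<close> on either side of \<open>t\<close>. Since \<open>\<theta>\<close> has integral at most \<open>1/2\<close>, integral
    operators with this kernel are contractions in the norm weighted by \<open>w\<close>, both forward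
    (from \<open>t0\<close> to \<open>t\<close>) and backward (from infinity to \<open>t\<close>).
  \<^item> \<open>M * \<kappa> t s\<close>, for \<open>s \<ge> t\<close>. Its integral over \<open>s\<close> tends to 0 as \<open>t\<close> grows. The first
    majorant has the integral \<open>M * w t\<close> times a tail of the integral of \<open>\<theta>\<close>, which need not tend to 0 when
    \<open>w\<close> is unbounded.

  The bound on \<open>\<Phi> (t - t0)\<close> says that solutions of the linear system are of size \<open>w\<close>. The second majorant is
  demanded only from \<open>t0 + 1\<close> on, because it will be obtained from a kernel based at \<open>t - 1\<close>.\<close>
locale perturbed_flow = linear_flow A \<Phi>
  for A :: "'a::euclidean_space \<Rightarrow>\<^sub>L 'a" and \<Phi> +
  fixes f :: "real \<Rightarrow> 'a \<Rightarrow> 'a" and \<eta> w \<theta> :: "real \<Rightarrow> real"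
    and \<kappa> :: "real \<Rightarrow> real \<Rightarrow> real" and B t0 :: real
  assumes f_cont: "continuous_on UNIV (\<lambda>(t, x). f t x)"
    and f_zero: "\<And>t. f t 0 = 0"
    and lipschitz: "\<And>t x1 x2. t \<ge> t0 \<Longrightarrow> norm (f t x1 - f t x2) \<le> \<eta> t * norm (x1 - x2)"
    and \<eta>_nonneg: "\<And>t. t \<ge> t0 \<Longrightarrow> 0 \<le> \<eta> t"
    and w_pos: "\<And>t. t \<ge> t0 \<Longrightarrow> 0 < w t"
    and w_cont: "continuous_on {t0..} w"
    and B_nonneg: "0 \<le> B"
    and flow_growth: "\<And>t v. t \<ge> t0 \<Longrightarrow> norm (\<Phi> (t - t0) v) \<le> B * w t * norm v"
    and \<theta>_integrable: "\<theta> integrable_on {t0..}"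
    and \<theta>_nonneg: "\<And>s. s \<ge> t0 \<Longrightarrow> 0 \<le> \<theta> s"
    and \<theta>_half: "integral {t0..} \<theta> \<le> 1 / 2"
    and \<theta>_kernel: "\<And>s t M v. \<lbrakk>s \<ge> t0; t \<ge> t0; 0 \<le> M; norm v \<le> \<eta> s * (M * w s)\<rbrakk>
        \<Longrightarrow> norm (\<Phi> (t - s) v) \<le> M * w t * \<theta> s"
    and \<kappa>_integrable: "\<And>t. t \<ge> t0 + 1 \<Longrightarrow> \<kappa> t integrable_on {t..}"
    and \<kappa>_kernel: "\<And>s t M v. \<lbrakk>t \<ge> t0 + 1; s \<ge> t; 0 \<le> M; norm v \<le> \<eta> s * (M * w s)\<rbrakk>
        \<Longrightarrow> norm (\<Phi> (t - s) v) \<le> M * \<kappa> t s"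
    and \<kappa>_limit: "((\<lambda>t. integral {t..} (\<kappa> t)) \<longlongrightarrow> 0) at_top"
begin

definition weight_bounded :: "(real \<Rightarrow> 'a) \<Rightarrow> real \<Rightarrow> bool" where
  "weight_bounded y M \<longleftrightarrow> (\<forall>t\<ge>t0. norm (y t) \<le> M * w t)"

text \<open>The backward Duhamel term: subtracting it from a solution of the linear system imposes the
  perturbed equation while prescribing the behaviour at infinity in place of an initial value.\<close>
definition tail :: "(real \<Rightarrow> 'a) \<Rightarrow> real \<Rightarrow> 'a" where
  "tail y t = integral {t..} (\<lambda>s. \<Phi> (t - s) (f s (y s)))"

lemma weight_bounded_nonneg: "weight_bounded y M \<Longrightarrow> 0 \<le> M"
  unfolding weight_bounded_def using w_pos[of t0]
  by (metis norm_ge_zero order.refl order_trans zero_le_mult_iff not_less)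

lemma \<theta>_integrable_on_subset:
  assumes "S \<subseteq> {t0..}" "S \<in> sets lebesgue"
  shows "\<theta> integrable_on S" "integral S \<theta> \<le> 1 / 2"
proof -
  have "\<theta> absolutely_integrable_on {t0..}"
    using \<theta>_integrable \<theta>_nonneg by (intro nonnegative_absolutely_integrable_1) auto
  then have "\<theta> absolutely_integrable_on S"
    by (rule set_integrable_subset) (use assms in auto)
  then show *: "\<theta> integrable_on S"
    by (rule set_lebesgue_integral_eq_integral(1))
  have "integral S \<theta> \<le> integral {t0..} \<theta>"
    using assms(1) * \<theta>_integrable \<theta>_nonneg by (intro integral_subset_le) auto
  then show "integral S \<theta> \<le> 1 / 2" using \<theta>_half by linarith
qed

lemma kernel_difference:
  assumes "s \<ge> t0" "t \<ge> t0" "0 \<le> M" "norm (u - v) \<le> M * w s"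
  shows "norm (\<Phi> (t - s) (f s u - f s v)) \<le> M * w t * \<theta> s"
proof -
  have "norm (f s u - f s v) \<le> \<eta> s * norm (u - v)" by (rule lipschitz[OF assms(1)])
  also have "\<dots> \<le> \<eta> s * (M * w s)"
    using assms(4) \<eta>_nonneg[OF assms(1)] by (rule mult_left_mono)
  finally show ?thesis using assms by (intro \<theta>_kernel)
qed

lemma forcing_continuous:
  assumes "continuous_on {t0..} y"
  shows "continuous_on {t0..} (\<lambda>s. f s (y s))"
proof -
  have "continuous_on {t0..} (\<lambda>s. (s, y s))"
    using assms by (intro continuous_intros)
  from continuous_on_compose2[OF f_cont this] show ?thesis by simp
qed

lemma integrand_continuous:
  assumes "continuous_on {t0..} y"
  shows "continuous_on {t0..} (\<lambda>s. \<Phi> (t - s) (f s (y s)))"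
  using forcing_continuous[OF assms] by (intro continuous_intros)

lemma integrand_integrable:
  assumes y: "continuous_on {t0..} y" "weight_bounded y M" and "t \<ge> t0"
    and S: "S \<subseteq> {t0..}" "S \<in> sets lebesgue"
  shows "(\<lambda>s. \<Phi> (t - s) (f s (y s))) integrable_on S"
proof -
  have "(\<lambda>s. \<Phi> (t - s) (f s (y s))) absolutely_integrable_on {t0..}"
  proof (rule measurable_bounded_by_integrable_imp_absolutely_integrable)
    show "(\<lambda>s. \<Phi> (t - s) (f s (y s))) \<in> borel_measurable (lebesgue_on {t0..})"
      using integrand_continuous[OF y(1)] by (rule continuous_imp_measurable_on_sets_lebesgue) simp
    show "(\<lambda>s. M * w t * \<theta> s) integrable_on {t0..}"
      using \<theta>_integrable by (rule integrable_on_mult_right)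
    show "norm (\<Phi> (t - s) (f s (y s))) \<le> M * w t * \<theta> s" if "s \<in> {t0..}" for s
      using kernel_difference[of s t M "y s" 0] that assms weight_bounded_nonneg[OF y(2)]
      by (simp add: weight_bounded_def f_zero)
  qed simp
  then have "(\<lambda>s. \<Phi> (t - s) (f s (y s))) absolutely_integrable_on S"
    by (rule set_integrable_subset) (use S in auto)
  then show ?thesis by (rule set_lebesgue_integral_eq_integral(1))
qed

text \<open>The contraction estimate for the tail operator in the weighted norm.\<close>
lemma tail_diff_le:
  assumes y1: "continuous_on {t0..} y1" "weight_bounded y1 M1"
    and y2: "continuous_on {t0..} y2" "weight_bounded y2 M2"
    and d: "weight_bounded (\<lambda>s. y1 s - y2 s) M" and t: "t \<ge> t0"
  shows "norm (tail y1 t - tail y2 t) \<le> M * w t / 2"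
proof -
  note int = integrand_integrable[OF y1 t, of "{t..}"] integrand_integrable[OF y2 t, of "{t..}"]
  note M = weight_bounded_nonneg[OF d]
  have "tail y1 t - tail y2 t = integral {t..} (\<lambda>s. \<Phi> (t - s) (f s (y1 s) - f s (y2 s)))"
    unfolding tail_def using int t
    by (subst Henstock_Kurzweil_Integration.integral_diff[symmetric]) (auto simp: blinfun.bilinear_simps)
  also have "norm \<dots> \<le> integral {t..} (\<lambda>s. M * w t * \<theta> s)"
  proof (rule Henstock_Kurzweil_Integration.integral_norm_bound_integral)
    show "(\<lambda>s. \<Phi> (t - s) (f s (y1 s) - f s (y2 s))) integrable_on {t..}"
      using integrable_diff[OF int] t by (auto simp: blinfun.bilinear_simps)
    show "(\<lambda>s. M * w t * \<theta> s) integrable_on {t..}"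
      using t by (intro integrable_on_mult_right \<theta>_integrable_on_subset) auto
    show "norm (\<Phi> (t - s) (f s (y1 s) - f s (y2 s))) \<le> M * w t * \<theta> s" if "s \<in> {t..}" for s
      using that t d M by (intro kernel_difference) (auto simp: weight_bounded_def)
  qed
  also have "\<dots> = M * w t * integral {t..} \<theta>"
    by simp
  also have "\<dots> \<le> M * w t * (1 / 2)"
    using t M less_imp_le[OF w_pos[OF t]]
    by (intro mult_left_mono \<theta>_integrable_on_subset) auto
  finally show ?thesis by simp
qed

lemma tail_zero: "tail (\<lambda>s. 0) t = 0"
  by (simp add: tail_def f_zero)

lemma weight_bounded_zero: "weight_bounded (\<lambda>s. 0) 0"
  by (simp add: weight_bounded_def)

lemma tail_le:
  assumes y: "continuous_on {t0..} y" "weight_bounded y M" and t: "t \<ge> t0"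
  shows "norm (tail y t) \<le> M * w t / 2"
  using tail_diff_le[OF y _ weight_bounded_zero _ t, of M] y(2) by (simp add: tail_zero)

text \<open>This is where corresponding solutions become asymptotic: their difference is the tail.\<close>
lemma tail_tendsto_0:
  assumes y: "continuous_on {t0..} y" "weight_bounded y M"
  shows "(tail y \<longlongrightarrow> 0) at_top"
proof (rule tendsto_0_le[OF \<kappa>_limit, of _ M])
  have "norm (tail y t) \<le> norm (integral {t..} (\<kappa> t)) * M" if t: "t \<ge> t0 + 1" for t
  proof -
    note M = weight_bounded_nonneg[OF y(2)]
    have "norm (tail y t) \<le> integral {t..} (\<lambda>s. M * \<kappa> t s)"
      unfolding tail_def
    proof (rule Henstock_Kurzweil_Integration.integral_norm_bound_integral)
      show "(\<lambda>s. \<Phi> (t - s) (f s (y s))) integrable_on {t..}"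
        using t by (intro integrand_integrable[OF y]) auto
      show "(\<lambda>s. M * \<kappa> t s) integrable_on {t..}"
        using \<kappa>_integrable[OF t] by (rule integrable_on_mult_right)
      show "norm (\<Phi> (t - s) (f s (y s))) \<le> M * \<kappa> t s" if "s \<in> {t..}" for s
      proof -
        have s: "s \<ge> t" "s \<ge> t0" using that t by auto
        have "norm (f s (y s)) \<le> \<eta> s * norm (y s)"
          using lipschitz[OF s(2), of "y s" 0] by (simp add: f_zero)
        also have "\<dots> \<le> \<eta> s * (M * w s)"
          using y(2) s \<eta>_nonneg[OF s(2)] by (intro mult_left_mono) (auto simp: weight_bounded_def)
        finally show ?thesis using \<kappa>_kernel[OF t s(1) M] by blast
      qed
    qed
    also have "\<dots> \<le> norm (integral {t..} (\<kappa> t)) * M"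
      using M by (simp add: mult.commute mult_left_mono)
    finally show ?thesis .
  qed
  then show "\<forall>\<^sub>F t in at_top. norm (tail y t) \<le> norm (integral {t..} (\<kappa> t)) * M"
    by (auto simp: eventually_at_top_linorder)
qed

text \<open>Factoring out \<open>\<Phi> (t - t0)\<close> leaves an integral over \<open>[t, \<infinity>)\<close> of a function independent of \<open>t\<close>,
  which is differentiated as a constant minus an integral over \<open>[t0, t]\<close>.\<close>
lemma tail_deriv:
  assumes y: "continuous_on {t0..} y" "weight_bounded y M" and t: "t \<ge> t0"
  shows "(tail y has_vector_derivative A (tail y t) - f t (y t)) (at t within {t0..})"
proof -
  define G where "G s = \<Phi> (t0 - s) (f s (y s))" for s
  have G_int: "G integrable_on S" if "S \<subseteq> {t0..}" "S \<in> sets lebesgue" for S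
    unfolding G_def[abs_def] using integrand_integrable[OF y order_refl that] .
  have tail_eq: "tail y u = \<Phi> (u - t0) (integral {t0..} G - integral {t0..u} G)" if u: "u \<ge> t0" for u
  proof -
    have split: "integral {t0..} G = integral {t0..u} G + integral {u..} G"
      using u by (intro integral_atLeast_split G_int) auto
    have "tail y u = integral {u..} (\<lambda>s. \<Phi> (u - t0) (G s))"
      by (simp add: tail_def G_def flow_add_apply)
    also have "\<dots> = \<Phi> (u - t0) (integral {u..} G)"
      using integral_linear[OF G_int[of "{u..}"] blinfun.bounded_linear_right[of "\<Phi> (u - t0)"]] u
      by (simp add: o_def)
    finally show ?thesis using split by simp
  qed
  have "continuous_on {t0..t + 1} G"
    unfolding G_def using integrand_continuous[OF y(1)] by (rule continuous_on_subset) auto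
  from integral_has_vector_derivative[OF this, of t]
  have "((\<lambda>u. integral {t0..u} G) has_vector_derivative G t) (at t within {t0..t + 1})"
    using t by auto
  moreover have "at t within {t0..t + 1} = at t within {t0..}"
    by (rule at_within_nhd[where S="{..<t + 1}"]) auto
  ultimately have "((\<lambda>u. integral {t0..} G - integral {t0..u} G) has_vector_derivative 0 - G t)
      (at t within {t0..})"
    by (intro has_vector_derivative_diff has_vector_derivative_const) simp
  from flow_apply_deriv[OF this, of t0]
  have "((\<lambda>u. \<Phi> (u - t0) (integral {t0..} G - integral {t0..u} G)) has_vector_derivative
     A (tail y t) - f t (y t)) (at t within {t0..})"
    using t by (simp add: tail_eq blinfun.minus_right G_def flow_add_apply)
  then show ?thesis
    by (rule has_vector_derivative_transform[rotated 2]) (use t tail_eq in auto)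
qed

definition solves :: "(real \<Rightarrow> 'a \<Rightarrow> 'a) \<Rightarrow> (real \<Rightarrow> 'a) \<Rightarrow> bool" where
  "solves F y \<longleftrightarrow> (\<forall>t\<ge>t0. (y has_vector_derivative F t (y t)) (at t within {t0..}))"

lemma solves_continuous: "solves F y \<Longrightarrow> continuous_on {t0..} y"
  unfolding solves_def continuous_on_eq_continuous_within
  by (blast intro: has_vector_derivative_continuous elim: atLeast_iff[THEN iffD1])

abbreviation rhs where "rhs \<equiv> (\<lambda>t y. A y + f t y)"
abbreviation linear_rhs where "linear_rhs \<equiv> (\<lambda>(t::real) x. blinfun_apply A x)"

lemma linear_solution:
  assumes "solves linear_rhs x" "t \<ge> t0"
  shows "x t = \<Phi> (t - t0) (x t0)"
proof -
  have "((\<lambda>s. 0) has_integral x t - \<Phi> (t - t0) (x t0)) {t0..t}"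
    using variation_of_constants[of t0 x "\<lambda>t. 0" t] assms by (simp add: solves_def)
  then show ?thesis using has_integral_unique has_integral_0 by fastforce
qed

text \<open>Uniqueness, continuous dependence and the a priori bound on solutions all come from this estimate.
  On a compact interval let \<open>M\<close> be the maximum of the weighted difference. The forward integral
  equation bounds \<open>M\<close> by the contribution of the initial values plus \<open>M / 2\<close>, since the forward kernel
  is dominated by \<open>\<theta>\<close>. The term \<open>M / 2\<close> is absorbed on the left.\<close>
lemma solution_diff_le:
  assumes y1: "solves rhs y1" and y2: "solves rhs y2"
  shows "weight_bounded (\<lambda>t. y1 t - y2 t) (2 * B * norm (y1 t0 - y2 t0))"
  unfolding weight_bounded_def
proof (intro allI impI)
  fix T assume T: "T \<ge> t0"
  define d where "d t = y1 t - y2 t" for t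
  define g where "g t = f t (y1 t) - f t (y2 t)" for t
  have d_cont: "continuous_on {t0..T} d"
    unfolding d_def
    by (intro continuous_intros continuous_on_subset[OF solves_continuous[OF y1]]
        continuous_on_subset[OF solves_continuous[OF y2]]) auto
  have d_deriv: "(d has_vector_derivative A (d t) + g t) (at t within {t0..})" if "t \<ge> t0" for t
  proof -
    have "(d has_vector_derivative (A (y1 t) + f t (y1 t)) - (A (y2 t) + f t (y2 t)))
        (at t within {t0..})"
      unfolding d_def using y1 y2 that by (intro has_vector_derivative_diff) (auto simp: solves_def)
    then show ?thesis by (simp add: d_def g_def blinfun.bilinear_simps algebra_simps)
  qed
  have "\<exists>s\<in>{t0..T}. \<forall>t\<in>{t0..T}. norm (d t) / w t \<le> norm (d s) / w s"
  proof (rule continuous_attains_sup)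
    show "continuous_on {t0..T} (\<lambda>t. norm (d t) / w t)"
      using d_cont w_pos
      by (intro continuous_intros continuous_on_subset[OF w_cont]) (auto simp: less_le)
  qed (use T in auto)
  then obtain s where s: "s \<in> {t0..T}" and
    max: "\<And>t. t \<in> {t0..T} \<Longrightarrow> norm (d t) / w t \<le> norm (d s) / w s" by blast
  define M where "M = norm (d s) / w s"
  have ws: "w s > 0" using w_pos s by auto
  have M: "0 \<le> M" using ws by (simp add: M_def)
  have d_le: "norm (d t) \<le> M * w t" if "t \<in> {t0..T}" for t
    using max[OF that] w_pos[of t] that by (simp add: M_def field_simps)
  \<comment> \<open>The forward integral equation at the point \<open>s\<close> where the maximum is attained.\<close>
  have "norm (d s - \<Phi> (s - t0) (d t0)) \<le> integral {t0..s} (\<lambda>r. M * w s * \<theta> r)"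
  proof -
    have i: "((\<lambda>r. \<Phi> (s - r) (g r)) has_integral d s - \<Phi> (s - t0) (d t0)) {t0..s}"
      using d_deriv s by (intro variation_of_constants) auto
    have "norm (integral {t0..s} (\<lambda>r. \<Phi> (s - r) (g r))) \<le> integral {t0..s} (\<lambda>r. M * w s * \<theta> r)"
    proof (rule Henstock_Kurzweil_Integration.integral_norm_bound_integral)
      show "(\<lambda>r. \<Phi> (s - r) (g r)) integrable_on {t0..s}" using i by blast
      show "(\<lambda>r. M * w s * \<theta> r) integrable_on {t0..s}"
        by (intro integrable_on_mult_right \<theta>_integrable_on_subset) auto
      show "norm (\<Phi> (s - r) (g r)) \<le> M * w s * \<theta> r" if "r \<in> {t0..s}" for r
        unfolding g_def using that s d_le[of r] M by (intro kernel_difference) (auto simp: d_def)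
    qed
    then show ?thesis using integral_unique[OF i] by simp
  qed
  also have "\<dots> = M * w s * integral {t0..s} \<theta>"
    by simp
  also have "\<dots> \<le> M * w s * (1 / 2)"
    using M ws by (intro mult_left_mono \<theta>_integrable_on_subset) auto
  finally have "norm (d s) \<le> norm (\<Phi> (s - t0) (d t0)) + M * w s / 2"
    using norm_triangle_sub[of "d s" "\<Phi> (s - t0) (d t0)"] by simp
  also have "\<dots> \<le> B * w s * norm (d t0) + M * w s / 2"
    using flow_growth[of s "d t0"] s by auto
  finally have "M * w s \<le> (B * norm (d t0) + M / 2) * w s"
    using ws by (simp add: M_def algebra_simps)
  then have "M \<le> 2 * B * norm (d t0)"
    using ws by simp
  then have "M * w T \<le> 2 * B * norm (d t0) * w T"
    using w_pos[OF T] by simp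
  then show "norm (y1 T - y2 T) \<le> 2 * B * norm (y1 t0 - y2 t0) * w T"
    using d_le[of T] T by (simp add: d_def)
qed

lemma zero_solves: "solves rhs (\<lambda>t. 0)"
  by (simp add: solves_def f_zero blinfun.bilinear_simps)

lemma solution_weight_bounded:
  "solves rhs y \<Longrightarrow> weight_bounded y (2 * B * norm (y t0))"
  using solution_diff_le[OF _ zero_solves, of y] by simp

lemma add_tail_solves:
  assumes "solves rhs y"
  shows "solves linear_rhs (\<lambda>t. y t + tail y t)"
  unfolding solves_def
proof (intro allI impI)
  fix t assume "t \<ge> t0"
  then have "((\<lambda>t. y t + tail y t) has_vector_derivative
      (A (y t) + f t (y t)) + (A (tail y t) - f t (y t))) (at t within {t0..})"
    using assms
    by (intro has_vector_derivative_add
        tail_deriv[OF solves_continuous[OF assms] solution_weight_bounded[OF assms]])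
      (auto simp: solves_def)
  then show "((\<lambda>t. y t + tail y t) has_vector_derivative A (y t + tail y t)) (at t within {t0..})"
    by (simp add: blinfun.bilinear_simps)
qed

lemma diff_tail_solves:
  assumes x: "solves linear_rhs x" and y: "continuous_on {t0..} y" "weight_bounded y M"
    and eq: "\<And>t. t \<ge> t0 \<Longrightarrow> y t + tail y t = x t"
  shows "solves rhs y"
  unfolding solves_def
proof (intro allI impI)
  fix t assume t: "t \<ge> t0"
  have y_eq: "y u = x u - tail y u" if "u \<ge> t0" for u
    using eq[OF that] by (metis add_diff_cancel_right')
  have "((\<lambda>t. x t - tail y t) has_vector_derivative A (x t) - (A (tail y t) - f t (y t)))
      (at t within {t0..})"
    using x t by (intro has_vector_derivative_diff tail_deriv[OF y]) (auto simp: solves_def)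
  then have "((\<lambda>t. x t - tail y t) has_vector_derivative A (y t) + f t (y t))
      (at t within {t0..})"
    using eq[OF t, symmetric] by (simp add: blinfun.bilinear_simps)
  then show "(y has_vector_derivative A (y t) + f t (y t)) (at t within {t0..})"
    by (rule has_vector_derivative_transform[rotated 2]) (use t y_eq in auto)
qed

lemma linear_weight_bounded:
  assumes "solves linear_rhs x"
  shows "weight_bounded x (B * norm (x t0))"
  unfolding weight_bounded_def
proof (intro allI impI)
  fix t assume t: "t \<ge> t0"
  have "norm (x t) = norm (\<Phi> (t - t0) (x t0))"
    using linear_solution[OF assms t] by simp
  then show "norm (x t) \<le> B * norm (x t0) * w t"
    using flow_growth[OF t, of "x t0"] by (simp add: mult_ac)
qed

text \<open>For a given \<open>x\<close> the equation \<open>y + tail y = x\<close> is the fixed point equation of \<open>y \<mapsto> x - tail y\<close>, a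
  contraction with constant \<open>1/2\<close> in the weighted norm. To apply Banach's theorem in the space of bounded
  continuous functions on the whole line, functions are divided by the weight and extended to the left
  of \<open>t0\<close> by their value at \<open>t0\<close>; this is the role of \<open>max t0 t\<close>.\<close>
lemma add_tail_surjective:
  assumes x: "continuous_on {t0..} x" "weight_bounded x N"
  obtains y M where "continuous_on {t0..} y" "weight_bounded y M"
    "\<And>t. t \<ge> t0 \<Longrightarrow> y t + tail y t = x t"
proof -
  define scaled :: "(real \<Rightarrow>\<^sub>C 'a) \<Rightarrow> real \<Rightarrow> 'a" where "scaled z t = w t *\<^sub>R z t" for z t
  have scaled_cont: "continuous_on {t0..} (scaled z)" for z
    unfolding scaled_def[abs_def] using w_cont
    by (intro continuous_intros) auto
  have scaled_bound: "weight_bounded (scaled z) (norm z)" for z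
    unfolding weight_bounded_def scaled_def
    using norm_bounded[of z] w_pos by (auto simp: less_imp_le mult.commute intro!: mult_right_mono)
  have tail_cont: "continuous_on {t0..} (tail (scaled z))" for z
    unfolding continuous_on_eq_continuous_within
    using tail_deriv[OF scaled_cont scaled_bound] has_vector_derivative_continuous by blast
  define T where "T z t = (1 / w (max t0 t)) *\<^sub>R (x (max t0 t) - tail (scaled z) (max t0 t))" for z t
  have "T z \<in> bcontfun" for z
  proof (rule bcontfun_normI)
    have "continuous_on {t0..} (\<lambda>t. (1 / w t) *\<^sub>R (x t - tail (scaled z) t))"
      using w_pos by (intro continuous_intros w_cont x tail_cont) (auto simp: less_le)
    moreover have "continuous_on UNIV (\<lambda>t. max t0 t)"
      by (intro continuous_intros)
    ultimately show "continuous_on UNIV (T z)"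
      unfolding T_def[abs_def] by (rule continuous_on_compose2) auto
    fix t
    let ?t = "max t0 t"
    have t: "?t \<ge> t0" by simp
    have "norm (x ?t - tail (scaled z) ?t) \<le> N * w ?t + norm z * w ?t / 2"
      using x(2) t tail_le[OF scaled_cont scaled_bound t, of z] norm_triangle_ineq4
      unfolding weight_bounded_def by (smt (verit))
    then show "norm (T z t) \<le> N + norm z / 2"
      using w_pos[OF t] by (simp add: T_def pos_divide_le_eq algebra_simps del: scaleR_diff_right)
  qed
  then have T_apply: "apply_bcontfun (Bcontfun (T z)) = T z" for z
    by (simp add: Bcontfun_inverse)
  have "\<exists>!z. Bcontfun (T z) = z"
  proof (rule banach_fix_type)
    show "\<forall>z z'. dist (Bcontfun (T z)) (Bcontfun (T z')) \<le> 1 / 2 * dist z z'"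
    proof (intro allI dist_bound)
      fix z z' t
      let ?t = "max t0 t"
      have t: "?t \<ge> t0" by simp
      have "weight_bounded (\<lambda>s. scaled z' s - scaled z s) (dist z z')"
        unfolding weight_bounded_def scaled_def
      proof (intro allI impI)
        fix s assume "s \<ge> t0"
        then show "norm (w s *\<^sub>R z' s - w s *\<^sub>R z s) \<le> dist z z' * w s"
          using dist_bounded[of z' s z] w_pos[of s]
          by (simp add: scaleR_diff_right[symmetric] dist_norm[symmetric] dist_commute mult.commute)
      qed
      from tail_diff_le[OF scaled_cont scaled_bound scaled_cont scaled_bound this t]
      have *: "norm (tail (scaled z') ?t - tail (scaled z) ?t) \<le> dist z z' * w ?t / 2" .
      have "dist (T z t) (T z' t) = norm (tail (scaled z') ?t - tail (scaled z) ?t) / w ?t"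
        using w_pos[OF t] by (simp add: T_def dist_norm scaleR_diff_right[symmetric])
      also have "\<dots> \<le> 1 / 2 * dist z z'"
        using * w_pos[OF t] by (simp add: field_simps)
      finally show "dist (Bcontfun (T z) t) (Bcontfun (T z') t) \<le> 1 / 2 * dist z z'"
        by (simp add: T_apply)
    qed
  qed auto
  then obtain z where z: "Bcontfun (T z) = z" by blast
  have "scaled z t + tail (scaled z) t = x t" if t: "t \<ge> t0" for t
  proof -
    have "apply_bcontfun z t = T z t" using T_apply[of z] z by simp
    then show ?thesis using t w_pos[OF t] by (simp add: scaled_def T_def)
  qed
  with scaled_cont scaled_bound show ?thesis by (rule that)
qed

text \<open>The converse of continuous dependence: the difference of two perturbed solutions is controlled by
  the difference of the corresponding linear solutions at \<open>t0\<close>. The backward integral equation bounds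
  the weighted supremum \<open>r\<close> of the difference by a multiple of the linear difference plus \<open>r / 2\<close>;
  that \<open>r\<close> is finite is known from the forward estimate.\<close>
lemma solution_diff_le_linear_diff:
  assumes y1: "solves rhs y1" and y2: "solves rhs y2"
  shows "weight_bounded (\<lambda>t. y1 t - y2 t)
    (2 * B * norm ((y1 t0 + tail y1 t0) - (y2 t0 + tail y2 t0)))"
proof -
  define d where "d t = y1 t - y2 t" for t
  define x where "x t = (y1 t + tail y1 t) - (y2 t + tail y2 t)" for t
  have x: "solves linear_rhs x"
    unfolding x_def[abs_def] solves_def
    using add_tail_solves[OF y1] add_tail_solves[OF y2]
    by (auto simp: solves_def blinfun.diff_right intro!: has_vector_derivative_diff)
  define r where "r = (SUP t\<in>{t0..}. norm (d t) / w t)"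
  have "norm (d t) / w t \<le> 2 * B * norm (y1 t0 - y2 t0)" if "t \<ge> t0" for t
    using solution_diff_le[OF y1 y2] that w_pos[OF that]
    by (simp add: weight_bounded_def d_def field_simps)
  then have bdd: "bdd_above ((\<lambda>t. norm (d t) / w t) ` {t0..})"
    by (auto intro!: bdd_aboveI2)
  have "norm (d t) / w t \<le> r" if "t \<ge> t0" for t
    unfolding r_def using that by (intro cSUP_upper bdd) auto
  then have d_le: "weight_bounded d r"
    using w_pos by (simp add: weight_bounded_def field_simps)
  have "norm (d t) / w t \<le> B * norm (x t0) + r / 2" if t: "t \<ge> t0" for t
  proof -
    have "d t = x t - (tail y1 t - tail y2 t)"
      by (simp add: d_def x_def)
    then have "norm (d t) \<le> norm (x t) + norm (tail y1 t - tail y2 t)"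
      using norm_triangle_ineq4 by metis
    also have "norm (x t) \<le> B * norm (x t0) * w t"
      using linear_weight_bounded[OF x] t by (simp add: weight_bounded_def)
    also have "norm (tail y1 t - tail y2 t) \<le> r * w t / 2"
      using tail_diff_le[OF solves_continuous[OF y1] solution_weight_bounded[OF y1]
          solves_continuous[OF y2] solution_weight_bounded[OF y2], of r] d_le t
      unfolding d_def by blast
    finally show ?thesis using w_pos[OF t] by (simp add: field_simps)
  qed
  then have "r \<le> B * norm (x t0) + r / 2"
    unfolding r_def by (intro cSUP_least) auto
  then have "r \<le> 2 * B * norm (x t0)" by simp
  then have "weight_bounded d (2 * B * norm (x t0))"
    using d_le w_pos unfolding weight_bounded_def
    by (fastforce intro: order_trans mult_right_mono less_imp_le)
  then show ?thesis by (simp add: d_def[abs_def] x_def)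
qed

lemma solutions_iff: "y \<in> solutions G t0 \<longleftrightarrow> y \<in> extensional {t0..} \<and> solves G y"
  by (simp add: solutions_def solves_def)

lemma solves_restrict: "solves G (restrict y {t0..}) \<longleftrightarrow> solves G y"
proof -
  have "(restrict y {t0..} has_vector_derivative D) (at t within {t0..}) \<longleftrightarrow>
      (y has_vector_derivative D) (at t within {t0..})" if "t \<ge> t0" for t D
    using that by (auto intro: has_vector_derivative_transform[rotated 2])
  then show ?thesis by (auto simp: solves_def)
qed

lemma tail_restrict: "t \<ge> t0 \<Longrightarrow> tail (restrict y {t0..}) t = tail y t"
  unfolding tail_def by (intro integral_cong) auto

lemma extensional_eqI:
  assumes "y1 \<in> extensional {t0..}" "y2 \<in> extensional {t0..}" "weight_bounded (\<lambda>t. y1 t - y2 t) 0"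
  shows "y1 = y2"
  using assms by (intro extensionalityI[of _ "{t0..}"]) (auto simp: weight_bounded_def)

text \<open>The homeomorphism is \<open>y \<mapsto> y + tail y\<close>. It maps onto the solutions of the linear system by the fixed
  point argument, it is injective with Lipschitz inverse by the backward estimate, and Lipschitz by the
  forward estimate, all in terms of values at \<open>t0\<close>.\<close>
proposition asymptotically_equivalent_perturbation:
  assumes t0: "t0 \<ge> 0"
  shows "asymptotically_equivalent rhs linear_rhs"
proof -
  define h where "h y = restrict (\<lambda>t. y t + tail y t) {t0..}" for y
  have h_t0: "h y t0 = y t0 + tail y t0" for y
    by (simp add: h_def)
  have h_sol: "h y \<in> solutions linear_rhs t0" if "y \<in> solutions rhs t0" for y
    using that add_tail_solves[of y] by (simp add: solutions_iff h_def solves_restrict)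
  have inverse_bound: "weight_bounded (\<lambda>t. y1 t - y2 t) (2 * B * norm (h y1 t0 - h y2 t0))"
    if "y1 \<in> solutions rhs t0" "y2 \<in> solutions rhs t0" for y1 y2
    using that solution_diff_le_linear_diff[of y1 y2] by (simp add: solutions_iff h_t0)
  have "inj_on h (solutions rhs t0)"
  proof (rule inj_onI)
    fix y1 y2 assume "y1 \<in> solutions rhs t0" "y2 \<in> solutions rhs t0" "h y1 = h y2"
    then show "y1 = y2" using inverse_bound[of y1 y2] by (auto simp: solutions_iff intro: extensional_eqI)
  qed
  moreover have "\<exists>y\<in>solutions rhs t0. h y = x" if x: "x \<in> solutions linear_rhs t0" for x
  proof -
    have xs: "solves linear_rhs x" "x \<in> extensional {t0..}" using x by (auto simp: solutions_iff)
    obtain y M where y: "continuous_on {t0..} y" "weight_bounded y M"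
        "\<And>t. t \<ge> t0 \<Longrightarrow> y t + tail y t = x t"
      using add_tail_surjective[OF solves_continuous[OF xs(1)] linear_weight_bounded[OF xs(1)]]
      by blast
    have "restrict y {t0..} \<in> solutions rhs t0"
      using diff_tail_solves[OF xs(1) y] by (simp add: solutions_iff solves_restrict)
    moreover have "h (restrict y {t0..}) = x"
      using y(3) xs(2) by (intro extensionalityI[of _ "{t0..}"]) (auto simp: h_def tail_restrict)
    ultimately show ?thesis by blast
  qed
  ultimately have bij: "bij_betw h (solutions rhs t0) (solutions linear_rhs t0)"
    unfolding bij_betw_def using h_sol by blast
  define g where "g = inv_into (solutions rhs t0) h"
  have g_sol: "g x \<in> solutions rhs t0" "h (g x) = x" if "x \<in> solutions linear_rhs t0" for x
    using that bij_betw_inv_into_right[OF bij] bij_betw_apply[OF bij_betw_inv_into[OF bij]]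
    unfolding g_def by auto
  have g_h: "g (h y) = y" if "y \<in> solutions rhs t0" for y
    using that bij_betw_inv_into_left[OF bij] unfolding g_def by auto
  have "homeomorphic_maps (solution_topology rhs t0) (solution_topology linear_rhs t0) h g"
    unfolding homeomorphic_maps_def
  proof (intro conjI ballI)
    show "continuous_map (solution_topology rhs t0) (solution_topology linear_rhs t0) h"
      unfolding solution_topology_def
    proof (rule continuous_map_pullback_lipschitz[OF h_sol])
      fix y1 y2 assume "y1 \<in> solutions rhs t0" "y2 \<in> solutions rhs t0"
      then have y: "solves rhs y1" "solves rhs y2" by (auto simp: solutions_iff)
      have "norm (tail y1 t0 - tail y2 t0) \<le> 2 * B * norm (y1 t0 - y2 t0) * w t0 / 2"
        using tail_diff_le[OF solves_continuous[OF y(1)] solution_weight_bounded[OF y(1)]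
          solves_continuous[OF y(2)] solution_weight_bounded[OF y(2)] solution_diff_le[OF y]]
        by blast
      moreover have "norm (h y1 t0 - h y2 t0) \<le> norm (y1 t0 - y2 t0) + norm (tail y1 t0 - tail y2 t0)"
        unfolding h_t0 by (rule norm_diff_triangle_ineq)
      ultimately show "dist (h y1 t0) (h y2 t0) \<le> (1 + B * w t0) * dist (y1 t0) (y2 t0)"
        unfolding dist_norm by (simp add: algebra_simps)
    qed
    show "continuous_map (solution_topology linear_rhs t0) (solution_topology rhs t0) g"
      unfolding solution_topology_def
    proof (rule continuous_map_pullback_lipschitz[OF g_sol(1)])
      fix x1 x2 assume x: "x1 \<in> solutions linear_rhs t0" "x2 \<in> solutions linear_rhs t0"
      show "dist (g x1 t0) (g x2 t0) \<le> (2 * B * w t0) * dist (x1 t0) (x2 t0)"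
        using inverse_bound[of "g x1" "g x2"] g_sol[OF x(1)] g_sol[OF x(2)]
        by (simp add: weight_bounded_def dist_norm mult_ac)
    qed
  qed (use g_h g_sol in \<open>auto simp: solution_topology_def topspace_pullback_topology\<close>)
  then have "homeomorphic_map (solution_topology rhs t0) (solution_topology linear_rhs t0) h"
    by (auto simp: homeomorphic_map_maps)
  moreover have "((\<lambda>t. y t - h y t) \<longlongrightarrow> 0) at_top" if "y \<in> solutions rhs t0" for y
  proof -
    have y: "solves rhs y" using that by (simp add: solutions_iff)
    have "((\<lambda>t. - tail y t) \<longlongrightarrow> - 0) at_top"
      by (intro tendsto_minus tail_tendsto_0[OF solves_continuous[OF y] solution_weight_bounded[OF y]])
    moreover have "\<forall>\<^sub>F t in at_top. - tail y t = y t - h y t"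
      using eventually_ge_at_top[of t0] by eventually_elim (simp add: h_def)
    ultimately show ?thesis using tendsto_cong[of "\<lambda>t. - tail y t" "\<lambda>t. y t - h y t"] by simp
  qed
  moreover have "inj_on (\<lambda>y. y t0) (solutions rhs t0)"
  proof (rule inj_onI)
    fix y1 y2 assume "y1 \<in> solutions rhs t0" "y2 \<in> solutions rhs t0" "y1 t0 = y2 t0"
    then show "y1 = y2"
      using solution_diff_le[of y1 y2] by (auto simp: solutions_iff intro: extensional_eqI)
  qed
  moreover have "inj_on (\<lambda>x. x t0) (solutions linear_rhs t0)"
  proof (rule inj_onI)
    fix x1 x2
    assume "x1 \<in> solutions linear_rhs t0" "x2 \<in> solutions linear_rhs t0" and eq: "x1 t0 = x2 t0"
    then have x: "solves linear_rhs x1" "solves linear_rhs x2"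
        "x1 \<in> extensional {t0..}" "x2 \<in> extensional {t0..}"
      by (auto simp: solutions_iff)
    show "x1 = x2"
    proof (rule extensionalityI[OF x(3,4)])
      fix t assume "t \<in> {t0..}"
      then have t: "t0 \<le> t" by simp
      show "x1 t = x2 t"
        unfolding linear_solution[OF x(1) t] linear_solution[OF x(2) t] eq ..
    qed
  qed
  ultimately show ?thesis
    unfolding asymptotically_equivalent_def using t0 by blast
qed

end

section \<open>The exponential of a Jordan matrix\<close>

text \<open>\<open>E t\<close> is the exponential of \<open>t A\<close>. Derivatives are taken entrywise, a form that passes
  directly through similarity and block sums.\<close>
definition matrix_flow :: "nat \<Rightarrow> complex mat \<Rightarrow> (real \<Rightarrow> complex mat) \<Rightarrow> bool" where
  "matrix_flow n A E \<longleftrightarrow> A \<in> carrier_mat n n \<and> (\<forall>t. E t \<in> carrier_mat n n) \<and> E 0 = 1\<^sub>m n \<and>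
     (\<forall>t. A * E t = E t * A) \<and>
     (\<forall>t. \<forall>i<n. \<forall>j<n. ((\<lambda>t. E t $$ (i, j)) has_vector_derivative (A * E t) $$ (i, j)) (at t))"

lemma matrix_flow_deriv:
  assumes "matrix_flow n A E" "i < n" "j < n"
  shows "((\<lambda>t. E t $$ (i, j)) has_vector_derivative (A * E t) $$ (i, j)) (at t)"
  by (rule assms(1)[unfolded matrix_flow_def, THEN conjunct2, THEN conjunct2, THEN conjunct2,
        THEN conjunct2, rule_format, OF assms(2,3)])

definition entries_bounded :: "nat \<Rightarrow> (real \<Rightarrow> complex mat) \<Rightarrow> (real \<Rightarrow> real) \<Rightarrow> bool" where
  "entries_bounded n E g \<longleftrightarrow> (\<exists>K. \<forall>t. \<forall>i<n. \<forall>j<n. cmod (E t $$ (i, j)) \<le> K * g t)"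

lemma index_mult_mat_sum:
  fixes A B :: "'a::comm_semiring_0 mat"
  assumes "A \<in> carrier_mat n m" "B \<in> carrier_mat m k" "i < n" "j < k"
  shows "(A * B) $$ (i, j) = (\<Sum>l<m. A $$ (i, l) * B $$ (l, j))"
  using assms by (auto simp: scalar_prod_def atLeast0LessThan intro!: sum.cong)

lemma conjugate_entry:
  fixes P B Q :: "'a::comm_semiring_0 mat"
  assumes "P \<in> carrier_mat n n" "B \<in> carrier_mat n n" "Q \<in> carrier_mat n n" "i < n" "j < n"
  shows "(P * B * Q) $$ (i, j) = (\<Sum>l<n. \<Sum>k<n. P $$ (i, k) * Q $$ (l, j) * B $$ (k, l))"
proof -
  have "(P * B * Q) $$ (i, j) = (\<Sum>l<n. (P * B) $$ (i, l) * Q $$ (l, j))"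
    using assms by (intro index_mult_mat_sum) auto
  also have "\<dots> = (\<Sum>l<n. (\<Sum>k<n. P $$ (i, k) * B $$ (k, l)) * Q $$ (l, j))"
    using assms by (intro sum.cong refl arg_cong2[where f="(*)"] index_mult_mat_sum) auto
  finally show ?thesis by (simp add: sum_distrib_left sum_distrib_right mult_ac)
qed

text \<open>Conjugation is multiplicative, and the entries of \<open>P * E t * Q\<close> are fixed linear combinations of
  those of \<open>E t\<close>. The second fact also preserves bounds on the entries.\<close>
lemma matrix_flow_similar:
  assumes flow: "matrix_flow n B E"
    and PQ: "P \<in> carrier_mat n n" "Q \<in> carrier_mat n n" "P * Q = 1\<^sub>m n" "Q * P = 1\<^sub>m n"
  shows "matrix_flow n (P * B * Q) (\<lambda>t. P * E t * Q)"
proof -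
  have B: "B \<in> carrier_mat n n" and E: "\<And>t. E t \<in> carrier_mat n n" and E0: "E 0 = 1\<^sub>m n"
    and comm: "\<And>t. B * E t = E t * B"
    and deriv: "\<And>t i j. i < n \<Longrightarrow> j < n \<Longrightarrow>
        ((\<lambda>t. E t $$ (i, j)) has_vector_derivative (B * E t) $$ (i, j)) (at t)"
    using flow by (auto simp: matrix_flow_def)
  have conj_mult: "(P * X * Q) * (P * Y * Q) = P * (X * Y) * Q"
    if X: "X \<in> carrier_mat n n" and Y: "Y \<in> carrier_mat n n" for X Y
  proof -
    have "(P * X * Q) * (P * Y * Q) = P * X * (Q * (P * Y * Q))"
      using X Y PQ by (intro assoc_mult_mat) auto
    also have "Q * (P * Y * Q) = (Q * P) * (Y * Q)"
      using X Y PQ(1,2) by (simp add: assoc_mult_mat[of _ n n _ n _ n])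
    also have "\<dots> = Y * Q" using Y PQ by simp
    also have "P * X * (Y * Q) = P * (X * Y) * Q"
      using X Y PQ by (simp add: assoc_mult_mat[of _ n n _ n _ n])
    finally show ?thesis .
  qed
  have "((\<lambda>t. (P * E t * Q) $$ (i, j)) has_vector_derivative (P * (B * E t) * Q) $$ (i, j)) (at t)"
    if ij: "i < n" "j < n" for t i j
  proof -
    have BE: "B * E t \<in> carrier_mat n n" using B E by auto
    show ?thesis
      unfolding conjugate_entry[OF PQ(1) E PQ(2) ij] conjugate_entry[OF PQ(1) BE PQ(2) ij]
      by (intro has_vector_derivative_sum has_vector_derivative_mult_right deriv) auto
  qed
  moreover have "P * B * Q * (P * E t * Q) = P * (B * E t) * Q"
    "P * E t * Q * (P * B * Q) = P * (B * E t) * Q" for t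
    using conj_mult[OF B E] conj_mult[OF E B] by (simp_all only: comm)
  moreover have "P * E 0 * Q = 1\<^sub>m n"
    using PQ by (simp add: E0)
  ultimately show ?thesis
    unfolding matrix_flow_def using B E PQ(1,2) by (intro conjI allI impI) auto
qed

lemma entries_bounded_similar:
  assumes E: "\<And>t. E t \<in> carrier_mat n n" and bd: "entries_bounded n E g"
    and PQ: "P \<in> carrier_mat n n" "Q \<in> carrier_mat n n"
  shows "entries_bounded n (\<lambda>t. P * E t * Q) g"
proof -
  obtain K where K: "\<And>t i j. i < n \<Longrightarrow> j < n \<Longrightarrow> cmod (E t $$ (i, j)) \<le> K * g t"
    using bd by (auto simp: entries_bounded_def)
  define c where "c = (\<Sum>i<n. \<Sum>j<n. \<Sum>l<n. \<Sum>k<n. cmod (P $$ (i, k)) * cmod (Q $$ (l, j)))"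
  have "cmod ((P * E t * Q) $$ (i, j)) \<le> (c * K) * g t" if ij: "i < n" "j < n" for t i j
  proof -
    have pos: "0 \<le> K * g t" using K[OF ij, of t] norm_ge_zero order_trans by blast
    have "cmod ((P * E t * Q) $$ (i, j))
        \<le> (\<Sum>l<n. \<Sum>k<n. cmod (P $$ (i, k)) * cmod (Q $$ (l, j)) * cmod (E t $$ (k, l)))"
      unfolding conjugate_entry[OF PQ(1) E PQ(2) ij]
      by (intro sum_norm_le) (simp add: norm_mult)
    also have "\<dots> \<le> (\<Sum>l<n. \<Sum>k<n. cmod (P $$ (i, k)) * cmod (Q $$ (l, j)) * (K * g t))"
      by (intro sum_mono mult_left_mono K) auto
    also have "\<dots> = (\<Sum>l<n. \<Sum>k<n. cmod (P $$ (i, k)) * cmod (Q $$ (l, j))) * (K * g t)"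
      by (simp add: sum_distrib_right)
    also have "(\<Sum>l<n. \<Sum>k<n. cmod (P $$ (i, k)) * cmod (Q $$ (l, j)))
        \<le> (\<Sum>j<n. \<Sum>l<n. \<Sum>k<n. cmod (P $$ (i, k)) * cmod (Q $$ (l, j)))"
      using ij by (intro member_le_sum) (auto intro!: sum_nonneg)
    also have "\<dots> \<le> c"
      unfolding c_def using ij
      by (intro member_le_sum[of i "{..<n}" "\<lambda>i. \<Sum>j<n. \<Sum>l<n. \<Sum>k<n. cmod (P $$ (i, k)) * cmod (Q $$ (l, j))"])
        (auto intro!: sum_nonneg)
    finally show ?thesis using pos by (simp add: mult_right_mono mult.assoc)
  qed
  then show ?thesis unfolding entries_bounded_def by blast
qed

abbreviation block_diag :: "'a::zero mat \<Rightarrow> 'a mat \<Rightarrow> 'a mat" where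
  "block_diag A D \<equiv> four_block_mat A (0\<^sub>m (dim_row A) (dim_col D)) (0\<^sub>m (dim_row D) (dim_col A)) D"

lemma block_diag_mult:
  fixes A A' D D' :: "'a::semiring_1 mat"
  assumes "A \<in> carrier_mat n n" "A' \<in> carrier_mat n n" "D \<in> carrier_mat m m" "D' \<in> carrier_mat m m"
  shows "block_diag A D * block_diag A' D' = block_diag (A * A') (D * D')"
proof -
  have "block_diag A D * block_diag A' D' =
    four_block_mat (A * A' + 0\<^sub>m n m * 0\<^sub>m m n) (A * 0\<^sub>m n m + 0\<^sub>m n m * D')
      (0\<^sub>m m n * A' + D * 0\<^sub>m m n) (0\<^sub>m m n * 0\<^sub>m n m + D * D')"
    using assms by (simp add: mult_four_block_mat[of _ n n _ m _ m _ _ n _ m])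
  then show ?thesis
    using assms by (simp add: left_add_zero_mat[of _ n n] left_add_zero_mat[of _ m m])
qed

lemma matrix_flow_block_diag:
  assumes flow: "matrix_flow n A E" and flow': "matrix_flow m A' E'"
  shows "matrix_flow (n + m) (block_diag A A') (\<lambda>t. block_diag (E t) (E' t))"
proof -
  have A: "A \<in> carrier_mat n n" "A' \<in> carrier_mat m m"
    and E: "\<And>t. E t \<in> carrier_mat n n" "\<And>t. E' t \<in> carrier_mat m m"
    and deriv: "\<And>i j t. i < n \<Longrightarrow> j < n \<Longrightarrow>
        ((\<lambda>t. E t $$ (i, j)) has_vector_derivative (A * E t) $$ (i, j)) (at t)"
    and deriv': "\<And>i j t. i < m \<Longrightarrow> j < m \<Longrightarrow>
        ((\<lambda>t. E' t $$ (i, j)) has_vector_derivative (A' * E' t) $$ (i, j)) (at t)"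
    and comm: "\<And>t. A * E t = E t * A" and comm': "\<And>t. A' * E' t = E' t * A'"
    using flow flow' by (auto simp: matrix_flow_def)
  have "((\<lambda>t. block_diag (E t) (E' t) $$ (i, j)) has_vector_derivative
      block_diag (A * E t) (A' * E' t) $$ (i, j)) (at t)" if ij: "i < n + m" "j < n + m" for t i j
  proof -
    have "block_diag (E t) (E' t) $$ (i, j) = (if i < n then if j < n then E t $$ (i, j) else 0
        else if j < n then 0 else E' t $$ (i - n, j - n))" for t
      using carrier_matD[OF E(1)[of t]] carrier_matD[OF E(2)[of t]] ij by auto
    moreover have "block_diag (A * E t) (A' * E' t) $$ (i, j) =
        (if i < n then if j < n then (A * E t) $$ (i, j) else 0
        else if j < n then 0 else (A' * E' t) $$ (i - n, j - n))"
      using carrier_matD[OF E(1)[of t]] carrier_matD[OF E(2)[of t]]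
        carrier_matD[OF A(1)] carrier_matD[OF A(2)] ij by auto
    moreover have "i < n \<or> i - n < m" "j < n \<or> j - n < m" using ij by auto
    ultimately show ?thesis
      using deriv[of i j t] deriv'[of "i - n" "j - n" t]
      by (simp only: split: if_splits) auto
  qed
  moreover have "block_diag (E 0) (E' 0) = 1\<^sub>m (n + m)"
    using flow flow' by (simp add: matrix_flow_def)
  moreover have "block_diag A A' * block_diag (E t) (E' t) = block_diag (A * E t) (A' * E' t)"
    "block_diag (E t) (E' t) * block_diag A A' = block_diag (A * E t) (A' * E' t)" for t
    using block_diag_mult[OF A(1) E(1) A(2) E(2), of t t]
      block_diag_mult[OF E(1) A(1) E(2) A(2), of t t] comm[of t] comm'[of t]
    by metis+
  ultimately show ?thesis
    unfolding matrix_flow_def using A E by (intro conjI allI impI) auto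
qed

lemma entries_bounded_block_diag:
  assumes E: "\<And>t. E t \<in> carrier_mat n n" "\<And>t. E' t \<in> carrier_mat m m"
    and bd: "entries_bounded n E g" "entries_bounded m E' g" and g: "\<And>t. 0 \<le> g t"
  shows "entries_bounded (n + m) (\<lambda>t. block_diag (E t) (E' t)) g"
proof -
  obtain K where K: "\<And>t i j. i < n \<Longrightarrow> j < n \<Longrightarrow> cmod (E t $$ (i, j)) \<le> K * g t"
    using bd(1) by (auto simp: entries_bounded_def)
  obtain K' where K': "\<And>t i j. i < m \<Longrightarrow> j < m \<Longrightarrow> cmod (E' t $$ (i, j)) \<le> K' * g t"
    using bd(2) by (auto simp: entries_bounded_def)
  have "cmod (block_diag (E t) (E' t) $$ (i, j)) \<le> (\<bar>K\<bar> + \<bar>K'\<bar>) * g t"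
    if ij: "i < n + m" "j < n + m" for t i j
  proof -
    have "K * g t \<le> (\<bar>K\<bar> + \<bar>K'\<bar>) * g t" "K' * g t \<le> (\<bar>K\<bar> + \<bar>K'\<bar>) * g t" "0 \<le> (\<bar>K\<bar> + \<bar>K'\<bar>) * g t"
      using g[of t] by (auto intro!: mult_right_mono)
    moreover have "block_diag (E t) (E' t) $$ (i, j) = (if i < n then if j < n then E t $$ (i, j) else 0
        else if j < n then 0 else E' t $$ (i - n, j - n))"
      using carrier_matD[OF E(1)[of t]] carrier_matD[OF E(2)[of t]] ij by auto
    moreover have "i < n \<or> i - n < m" "j < n \<or> j - n < m" using ij by auto
    ultimately show ?thesis
      using K[of i j t] K'[of "i - n" "j - n" t] by (auto intro: order_trans)
  qed
  then show ?thesis unfolding entries_bounded_def by blast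
qed

text \<open>With \<open>N\<close> the nilpotent shift, \<open>exp (t (z + N)) = exp (t z) * exp (t N)\<close>, and \<open>exp (t N)\<close> has the
  entry \<open>t^d / d!\<close> on its \<open>d\<close>-th superdiagonal.\<close>
definition exp_jordan_block :: "nat \<Rightarrow> complex \<Rightarrow> real \<Rightarrow> complex mat" where
  "exp_jordan_block k z t = Matrix.mat k k
     (\<lambda>(i, j). if i \<le> j then of_real (t ^ (j - i) / fact (j - i)) * exp (of_real t * z) else 0)"

lemma exp_jordan_entry_deriv:
  fixes z :: complex
  shows "((\<lambda>t. of_real (t ^ d / fact d) * exp (of_real t * z)) has_vector_derivative
     z * (of_real (t ^ d / fact d) * exp (of_real t * z)) +
     (if d = 0 then 0 else of_real (t ^ (d - 1) / fact (d - 1)) * exp (of_real t * z))) (at t)"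
proof -
  have 1: "((\<lambda>t. exp (of_real t * z)) has_vector_derivative z * exp (of_real t * z)) (at t)"
    by (rule has_vector_derivative_real_field[where f="\<lambda>w. exp (w * z)"]) (auto intro!: derivative_eq_intros)
  have "((\<lambda>t::real. t ^ d / fact d) has_real_derivative
      (if d = 0 then 0 else t ^ (d - 1) / fact (d - 1))) (at t)"
  proof (cases d)
    case (Suc m)
    have "((\<lambda>t::real. t ^ d / fact d) has_real_derivative real (Suc m) * t ^ m / fact (Suc m)) (at t)"
      unfolding Suc using DERIV_cdivide[OF DERIV_pow[of "Suc m" t UNIV], of "fact (Suc m)"]
      by (simp del: fact_Suc power_Suc of_nat_Suc)
    moreover have "real (Suc m) * t ^ m / fact (Suc m) = t ^ m / fact m"
      unfolding fact_Suc of_nat_mult by (simp del: of_nat_Suc)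
    ultimately show ?thesis by (simp add: Suc)
  qed simp
  from has_vector_derivative_of_real[OF this, where 'a=complex]
  have 2: "((\<lambda>t. of_real (t ^ d / fact d)) has_vector_derivative
      (of_real (if d = 0 then 0 else t ^ (d - 1) / fact (d - 1)) :: complex)) (at t)" .
  from has_vector_derivative_mult[OF 2 1] show ?thesis
    by (auto simp: mult_ac add_ac)
qed

lemma exp_jordan_block_carrier [simp]: "exp_jordan_block k z t \<in> carrier_mat k k"
  by (simp add: exp_jordan_block_def)

lemma jordan_block_carrier': "jordan_block k z \<in> carrier_mat k k"
  by simp

lemma exp_jordan_block_index:
  "i < k \<Longrightarrow> j < k \<Longrightarrow> exp_jordan_block k z t $$ (i, j) =
    (if i \<le> j then of_real (t ^ (j - i) / fact (j - i)) * exp (of_real t * z) else 0)"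
  by (simp add: exp_jordan_block_def)

text \<open>Multiplying by a Jordan block on the left shifts rows, on the right it shifts columns. Since the
  entries depend only on \<open>j - i\<close>, the two shifts have the same effect.\<close>
lemma jordan_block_mult_exp:
  assumes ij: "i < k" "j < k"
  shows "(jordan_block k z * exp_jordan_block k z t) $$ (i, j) =
      z * exp_jordan_block k z t $$ (i, j) +
      (if i < j then exp_jordan_block k z t $$ (Suc i, j) else 0)"
proof -
  define e where "e l = exp_jordan_block k z t $$ (l, j)" for l
  have "(jordan_block k z * exp_jordan_block k z t) $$ (i, j) = (\<Sum>l<k. jordan_block k z $$ (i, l) * e l)"
    unfolding e_def using ij by (rule index_mult_mat_sum[OF jordan_block_carrier' exp_jordan_block_carrier])
  also have "\<dots> = (\<Sum>l<k. (if l = i then z * e l else 0) + (if l = Suc i then e l else 0))"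
    using ij by (intro sum.cong) auto
  also have "\<dots> = z * e i + (if Suc i < k then e (Suc i) else 0)"
    using ij by (simp add: sum.distrib)
  also have "(if Suc i < k then e (Suc i) else 0) = (if i < j then e (Suc i) else 0)"
    using ij by (auto simp: e_def exp_jordan_block_index)
  finally show ?thesis by (simp add: e_def)
qed

lemma exp_mult_jordan_block:
  assumes ij: "i < k" "j < k"
  shows "(exp_jordan_block k z t * jordan_block k z) $$ (i, j) =
      z * exp_jordan_block k z t $$ (i, j) +
      (if i < j then exp_jordan_block k z t $$ (i, j - 1) else 0)"
proof -
  define e where "e l = exp_jordan_block k z t $$ (i, l)" for l
  have "(exp_jordan_block k z t * jordan_block k z) $$ (i, j) = (\<Sum>l<k. e l * jordan_block k z $$ (l, j))"
    unfolding e_def using ij by (rule index_mult_mat_sum[OF exp_jordan_block_carrier jordan_block_carrier'])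
  also have "\<dots> = (\<Sum>l<k. (if l = j then z * e l else 0) + (if l = j - 1 \<and> j \<noteq> 0 then e l else 0))"
    using ij by (intro sum.cong) auto
  also have "\<dots> = z * e j + (if j \<noteq> 0 then e (j - 1) else 0)"
    using ij by (cases j) (simp_all add: sum.distrib)
  also have "(if j \<noteq> 0 then e (j - 1) else 0) = (if i < j then e (j - 1) else 0)"
    using ij by (auto simp: e_def exp_jordan_block_index)
  finally show ?thesis by (simp add: e_def)
qed

lemma matrix_flow_jordan_block: "matrix_flow k (jordan_block k z) (exp_jordan_block k z)"
proof -
  have carrier: "exp_jordan_block k z t \<in> carrier_mat k k" for t
    by (simp add: exp_jordan_block_def)
  have "exp_jordan_block k z 0 = 1\<^sub>m k"
    by (rule eq_matI) (auto simp: exp_jordan_block_def)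
  moreover have "jordan_block k z * exp_jordan_block k z t = exp_jordan_block k z t * jordan_block k z"
    for t
  proof (rule eq_matI)
    fix i j assume "i < dim_row (exp_jordan_block k z t * jordan_block k z)"
      "j < dim_col (exp_jordan_block k z t * jordan_block k z)"
    then have ij: "i < k" "j < k" by (simp_all add: exp_jordan_block_def)
    then have "exp_jordan_block k z t $$ (Suc i, j) = exp_jordan_block k z t $$ (i, j - 1)" if "i < j"
      using that by (auto simp: exp_jordan_block_def Suc_le_eq)
    then show "(jordan_block k z * exp_jordan_block k z t) $$ (i, j) =
        (exp_jordan_block k z t * jordan_block k z) $$ (i, j)"
      using jordan_block_mult_exp[OF ij] exp_mult_jordan_block[OF ij] by auto
  qed (simp_all add: exp_jordan_block_def)
  moreover have "((\<lambda>t. exp_jordan_block k z t $$ (i, j)) has_vector_derivative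
      (jordan_block k z * exp_jordan_block k z t) $$ (i, j)) (at t)" if ij: "i < k" "j < k" for i j t
  proof (cases "i \<le> j")
    case True
    have "exp_jordan_block k z t $$ (i, j) = of_real (t ^ (j - i) / fact (j - i)) * exp (of_real t * z)"
      for t using True ij by (simp add: exp_jordan_block_def)
    moreover have "(if i < j then exp_jordan_block k z t $$ (Suc i, j) else 0) =
       (if j - i = 0 then 0 else of_real (t ^ (j - i - 1) / fact (j - i - 1)) * exp (of_real t * z))"
      using True ij by (auto simp: exp_jordan_block_def)
    ultimately show ?thesis
      using exp_jordan_entry_deriv[of "j - i" z t] by (simp add: jordan_block_mult_exp[OF ij])
  next
    case False
    then have "exp_jordan_block k z t $$ (i, j) = 0" for t
      using ij by (simp add: exp_jordan_block_index)
    then show ?thesis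
      using False by (simp only: jordan_block_mult_exp[OF ij]) simp
  qed
  ultimately show ?thesis
    unfolding matrix_flow_def using carrier by auto
qed

text \<open>The two-sided bound on the exponential of \<open>t A\<close>: forward in time the largest real part \<open>\<beta>\<close> decides,
  backward in time the smallest real part \<open>\<alpha>\<close>; \<open>p + 1\<close> and \<open>q + 1\<close> are the sizes of the largest Jordan
  blocks on the two boundary lines.\<close>
definition growth_rate :: "nat \<Rightarrow> nat \<Rightarrow> real \<Rightarrow> real \<Rightarrow> real \<Rightarrow> real" where
  "growth_rate p q \<alpha> \<beta> t = (if 0 \<le> t then (1 + t) ^ p * exp (\<beta> * t) else (1 - t) ^ q * exp (\<alpha> * t))"

lemma growth_rate_nonneg: "0 \<le> growth_rate p q \<alpha> \<beta> t"
  by (simp add: growth_rate_def)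

lemma power_le_fact_exp:
  assumes "0 \<le> (x::real)"
  shows "x ^ n \<le> fact n * exp x"
proof -
  have "(\<Sum>k\<in>{n}. x ^ k / fact k) \<le> (\<Sum>k. x ^ k / fact k)"
    using assms summable_exp[of x]
    by (intro sum_le_suminf) (auto simp: divide_inverse mult.commute)
  also have "\<dots> = exp x"
    by (simp add: exp_def divide_inverse mult.commute)
  finally show ?thesis by (simp add: field_simps)
qed

text \<open>A strictly larger exponent absorbs every power; for equal exponents the powers must be compared.\<close>
lemma polynomial_exp_le:
  fixes r \<beta> :: real
  assumes "r < \<beta> \<or> (r = \<beta> \<and> k \<le> p)"
  shows "\<exists>K\<ge>0. \<forall>t\<ge>0. (1 + t) ^ k * exp (r * t) \<le> K * ((1 + t) ^ p * exp (\<beta> * t))"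
  using assms
proof
  assume r: "r < \<beta>"
  define c where "c = \<beta> - r"
  define K where "K = exp c * fact k / c ^ k"
  have c: "c > 0" using r by (simp add: c_def)
  have "(1 + t) ^ k * exp (r * t) \<le> K * ((1 + t) ^ p * exp (\<beta> * t))" if t: "t \<ge> 0" for t
  proof -
    have "(c * (1 + t)) ^ k \<le> fact k * exp (c * (1 + t))"
      using c t by (intro power_le_fact_exp) auto
    moreover have "exp (c * (1 + t)) = exp c * exp (c * t)"
      by (simp add: distrib_left exp_add)
    ultimately have "c ^ k * (1 + t) ^ k \<le> fact k * (exp c * exp (c * t))"
      by (simp only: power_mult_distrib)
    then have "(1 + t) ^ k \<le> K * exp (c * t)"
      using c by (simp add: K_def pos_le_divide_eq mult_ac)
    then have "(1 + t) ^ k * exp (r * t) \<le> K * exp (c * t) * exp (r * t)"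
      by (intro mult_right_mono) auto
    also have "\<dots> = K * (1 * exp (\<beta> * t))"
      by (simp add: c_def exp_add[symmetric] algebra_simps)
    also have "\<dots> \<le> K * ((1 + t) ^ p * exp (\<beta> * t))"
      using c t by (intro mult_left_mono mult_right_mono one_le_power) (auto simp: K_def)
    finally show ?thesis .
  qed
  moreover have "K \<ge> 0" using c by (simp add: K_def)
  ultimately show ?thesis by blast
next
  assume "r = \<beta> \<and> k \<le> p"
  then show ?thesis
    by (intro exI[of _ 1]) (auto intro!: mult_right_mono power_increasing)
qed

text \<open>The largest power of \<open>t\<close> in a block of size \<open>k\<close> is \<open>k - 1\<close>. For negative \<open>t\<close> the comparison of
  exponents is applied to \<open>- t\<close>, which turns \<open>\<alpha>\<close> into an upper bound.\<close>
lemma entries_bounded_exp_jordan_block: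
  assumes \<beta>: "Re z < \<beta> \<or> (Re z = \<beta> \<and> k - 1 \<le> p)"
    and \<alpha>: "\<alpha> < Re z \<or> (Re z = \<alpha> \<and> k - 1 \<le> q)"
  shows "entries_bounded k (exp_jordan_block k z) (growth_rate p q \<alpha> \<beta>)"
proof -
  obtain K1 where K1: "K1 \<ge> 0"
    "\<And>t. t \<ge> 0 \<Longrightarrow> (1 + t) ^ (k - 1) * exp (Re z * t) \<le> K1 * ((1 + t) ^ p * exp (\<beta> * t))"
    using polynomial_exp_le[OF \<beta>] by blast
  have "- Re z < - \<alpha> \<or> (- Re z = - \<alpha> \<and> k - 1 \<le> q)" using \<alpha> by auto
  then obtain K2 where K2: "K2 \<ge> 0"
    "\<And>t. t \<ge> 0 \<Longrightarrow> (1 + t) ^ (k - 1) * exp (- Re z * t) \<le> K2 * ((1 + t) ^ q * exp (- \<alpha> * t))"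
    using polynomial_exp_le[of "- Re z" "- \<alpha>"] by blast
  have "cmod (exp_jordan_block k z t $$ (i, j)) \<le> (K1 + K2) * growth_rate p q \<alpha> \<beta> t"
    if ij: "i < k" "j < k" for t i j
  proof (cases "i \<le> j")
    case True
    have "cmod (exp_jordan_block k z t $$ (i, j)) = \<bar>t\<bar> ^ (j - i) / fact (j - i) * exp (Re z * t)"
      using True by (simp add: exp_jordan_block_index[OF ij] norm_mult norm_divide norm_power mult.commute)
    also have "\<dots> \<le> (1 + \<bar>t\<bar>) ^ (k - 1) * exp (Re z * t)"
    proof (intro mult_right_mono)
      have "\<bar>t\<bar> ^ (j - i) / fact (j - i) \<le> \<bar>t\<bar> ^ (j - i) / 1"
        by (intro divide_left_mono fact_ge_1) auto
      also have "\<dots> \<le> (1 + \<bar>t\<bar>) ^ (j - i)" by (simp add: power_mono)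
      also have "\<dots> \<le> (1 + \<bar>t\<bar>) ^ (k - 1)" using ij by (intro power_increasing) auto
      finally show "\<bar>t\<bar> ^ (j - i) / fact (j - i) \<le> (1 + \<bar>t\<bar>) ^ (k - 1)" .
    qed simp
    also have "\<dots> \<le> (K1 + K2) * growth_rate p q \<alpha> \<beta> t"
    proof (cases "0 \<le> t")
      case True
      then have "(1 + \<bar>t\<bar>) ^ (k - 1) * exp (Re z * t) \<le> K1 * growth_rate p q \<alpha> \<beta> t"
        using K1(2)[of t] by (simp add: growth_rate_def)
      also have "\<dots> \<le> (K1 + K2) * growth_rate p q \<alpha> \<beta> t"
        using K2(1) by (intro mult_right_mono growth_rate_nonneg) simp
      finally show ?thesis .
    next
      case False
      then have "(1 + \<bar>t\<bar>) ^ (k - 1) * exp (Re z * t) \<le> K2 * growth_rate p q \<alpha> \<beta> t"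
        using K2(2)[of "- t"] by (simp add: growth_rate_def)
      also have "\<dots> \<le> (K1 + K2) * growth_rate p q \<alpha> \<beta> t"
        using K1(1) by (intro mult_right_mono growth_rate_nonneg) simp
      finally show ?thesis .
    qed
    finally show ?thesis .
  next
    case False
    then show ?thesis
      using K1(1) K2(1) growth_rate_nonneg by (simp add: exp_jordan_block_index[OF ij])
  qed
  then show ?thesis unfolding entries_bounded_def by blast
qed

lemma jordan_matrix_flow_exists:
  assumes "\<And>k z. (k, z) \<in> set n_as \<Longrightarrow>
    (Re z < \<beta> \<or> (Re z = \<beta> \<and> k - 1 \<le> p)) \<and> (\<alpha> < Re z \<or> (Re z = \<alpha> \<and> k - 1 \<le> q))"
  shows "\<exists>E. matrix_flow (sum_list (map fst n_as)) (jordan_matrix n_as) E \<and>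
    entries_bounded (sum_list (map fst n_as)) E (growth_rate p q \<alpha> \<beta>)"
  using assms
proof (induction n_as)
  case Nil
  have "matrix_flow 0 (jordan_matrix []) (\<lambda>t. 1\<^sub>m 0)"
    by (auto simp: matrix_flow_def jordan_matrix_def)
  moreover have "entries_bounded 0 (\<lambda>t. 1\<^sub>m 0) (growth_rate p q \<alpha> \<beta>)"
    by (simp add: entries_bounded_def)
  ultimately show ?case by auto
next
  case (Cons kz n_as)
  obtain k z where kz: "kz = (k, z)" by force
  let ?n = "sum_list (map fst n_as)"
  obtain E where E: "matrix_flow ?n (jordan_matrix n_as) E" "entries_bounded ?n E (growth_rate p q \<alpha> \<beta>)"
    using Cons by auto
  let ?E = "\<lambda>t. block_diag (exp_jordan_block k z t) (E t)"
  have "jordan_matrix (kz # n_as) = block_diag (jordan_block k z) (jordan_matrix n_as)"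
    unfolding kz jordan_matrix_Cons by simp
  then have "matrix_flow (k + ?n) (jordan_matrix (kz # n_as)) ?E"
    using matrix_flow_block_diag[OF matrix_flow_jordan_block E(1), of k z] by simp
  moreover have "entries_bounded k (exp_jordan_block k z) (growth_rate p q \<alpha> \<beta>)"
    using Cons.prems[of k z] by (intro entries_bounded_exp_jordan_block) (auto simp: kz)
  then have "entries_bounded (k + ?n) ?E (growth_rate p q \<alpha> \<beta>)"
    using E growth_rate_nonneg
    by (intro entries_bounded_block_diag) (auto simp: matrix_flow_def)
  ultimately show ?case by (auto simp: kz)
qed

lemma jordan_nf_flow_exists:
  assumes A: "A \<in> carrier_mat n n" and jnf: "jordan_nf A n_as"
    and blocks: "\<And>k z. (k, z) \<in> set n_as \<Longrightarrow>
      (Re z < \<beta> \<or> (Re z = \<beta> \<and> k - 1 \<le> p)) \<and> (\<alpha> < Re z \<or> (Re z = \<alpha> \<and> k - 1 \<le> q))"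
  obtains E where "matrix_flow n A E" "entries_bounded n E (growth_rate p q \<alpha> \<beta>)"
proof -
  obtain P Q where PQ: "similar_mat_wit A (jordan_matrix n_as) P Q"
    using jnf by (auto simp: jordan_nf_def similar_mat_def)
  note wit = similar_mat_witD2[OF A PQ]
  have n: "sum_list (map fst n_as) = n"
    using wit(5) by auto
  obtain E where E: "matrix_flow n (jordan_matrix n_as) E" "entries_bounded n E (growth_rate p q \<alpha> \<beta>)"
    using jordan_matrix_flow_exists[of n_as, OF blocks] unfolding n by blast
  have "matrix_flow n A (\<lambda>t. P * E t * Q)"
    unfolding wit(3) by (rule matrix_flow_similar[OF E(1) wit(6,7,1,2)])
  moreover have "entries_bounded n (\<lambda>t. P * E t * Q) (growth_rate p q \<alpha> \<beta>)"
    using E(1) by (intro entries_bounded_similar[OF _ E(2) wit(6,7)]) (simp add: matrix_flow_def)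
  ultimately show ?thesis by (rule that)
qed

section \<open>Growth of the flow of a real matrix\<close>

lemma jordan_nf_size_le:
  assumes "A \<in> carrier_mat n n" "jordan_nf A n_as" "(k, z) \<in> set n_as"
  shows "k \<le> n"
proof -
  obtain P Q where "similar_mat_wit A (jordan_matrix n_as) P Q"
    using assms(2) by (auto simp: jordan_nf_def similar_mat_def)
  from similar_mat_witD2(5)[OF assms(1) this] have "sum_list (map fst n_as) = n" by auto
  moreover have "k \<in> set (map fst n_as)" using assms(3) by force
  ultimately show ?thesis using member_le_sum_list[of k "map fst n_as"] by auto
qed

lemma jordan_nf_spectrum:
  fixes A :: "complex mat"
  assumes A: "A \<in> carrier_mat n n" and jnf: "jordan_nf A n_as"
  shows "spectrum A = snd ` set n_as"
proof -
  have pos: "k \<noteq> 0" if "(k, a) \<in> set n_as" for k a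
    using jnf that by (force simp: jordan_nf_def)
  have "poly (char_poly A) z = (\<Prod>(k, a)\<leftarrow>n_as. (z - a) ^ k)" for z
    unfolding jordan_nf_char_poly[OF jnf] poly_prod_list map_map
    by (intro arg_cong[where f=prod_list] map_cong) (auto simp: poly_power)
  then show ?thesis
    unfolding spectrum_root_char_poly[OF A] using pos by (force simp: prod_list_zero_iff)
qed

lemma complex_mat_carrier: "complex_mat (C :: real^'n^'n) \<in> carrier_mat CARD('n) CARD('n)"
  by (simp add: complex_mat_def)

lemma finite_elementary_divisor_degrees: "finite (elementary_divisor_degrees (C :: real^'n^'n) r)"
proof (rule finite_subset)
  show "elementary_divisor_degrees C r \<subseteq> {..CARD('n)}"
    using jordan_nf_size_le[OF complex_mat_carrier]
    by (auto simp: elementary_divisor_degrees_def)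
qed simp

lemma eigenvalue_re_parts_finite_nonempty:
  fixes C :: "real^'n^'n"
  shows "finite (eigenvalue_re_parts C)" "eigenvalue_re_parts C \<noteq> {}"
  using card_finite_spectrum(1)[OF complex_mat_carrier[of C]]
    spectrum_non_empty[OF complex_mat_carrier[of C]]
  by (simp_all add: eigenvalue_re_parts_def)

lemma complex_mat_jordan_nf_exists:
  fixes C :: "real^'n^'n"
  obtains n_as where "jordan_nf (complex_mat C) n_as"
  using jordan_nf_exists[OF complex_mat_carrier] char_poly_factorized[OF complex_mat_carrier] by metis

text \<open>Positivity makes the truncated subtractions of 1 from the two degrees genuine ones.\<close>
lemma Max_elementary_divisor_degrees_pos:
  fixes C :: "real^'n^'n"
  assumes "r \<in> eigenvalue_re_parts C"
  shows "1 \<le> Max (elementary_divisor_degrees C r)"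
proof -
  obtain n_as where jnf: "jordan_nf (complex_mat C) n_as" by (rule complex_mat_jordan_nf_exists)
  obtain k z where kz: "(k, z) \<in> set n_as" "Re z = r"
    using assms unfolding eigenvalue_re_parts_def jordan_nf_spectrum[OF complex_mat_carrier jnf] by auto
  have "k \<noteq> 0" using jnf kz by (force simp: jordan_nf_def)
  moreover have "k \<in> elementary_divisor_degrees C r"
    using jnf kz by (auto simp: elementary_divisor_degrees_def)
  then have "k \<le> Max (elementary_divisor_degrees C r)"
    by (intro Max_ge finite_elementary_divisor_degrees)
  ultimately show ?thesis by simp
qed

definition matrix_blinfun :: "real^'n^'n \<Rightarrow> (real^'n) \<Rightarrow>\<^sub>L (real^'n)" where
  "matrix_blinfun M = Blinfun (\<lambda>v. M *v v)"

lemma matrix_blinfun_apply [simp]: "blinfun_apply (matrix_blinfun M) v = M *v v"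
  unfolding matrix_blinfun_def
  by (simp add: bounded_linear_Blinfun_apply linear_conv_bounded_linear[symmetric])

lemma matrix_blinfun_mult: "matrix_blinfun (M ** N) = matrix_blinfun M o\<^sub>L matrix_blinfun N"
  by (intro blinfun_eqI) (simp add: matrix_vector_mul_assoc)

lemma bounded_linear_matrix_blinfun: "bounded_linear (matrix_blinfun :: real^'n^'n \<Rightarrow> _)"
  unfolding linear_conv_bounded_linear[symmetric]
  by (intro linearI blinfun_eqI)
    (simp_all add: blinfun.bilinear_simps matrix_vector_mult_add_rdistrib scaleR_matrix_vector_assoc)

lemma has_vector_derivative_matrix:
  fixes M :: "real \<Rightarrow> real^'n^'m"
  assumes "\<And>a b. ((\<lambda>t. vec_nth (vec_nth (M t) a) b) has_vector_derivative vec_nth (vec_nth M' a) b) (at t)"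
  shows "(M has_vector_derivative M') (at t)"
  unfolding has_vector_derivative_def
proof (subst has_derivative_componentwise_within, intro ballI)
  fix i :: "real^'n^'m" assume "i \<in> Basis"
  then obtain a b where "i = axis a (axis b 1)" by (auto simp: Basis_vec_def)
  then show "((\<lambda>x. M x \<bullet> i) has_derivative (\<lambda>x. (x *\<^sub>R M') \<bullet> i)) (at t)"
    using assms[of a b] by (simp add: inner_axis has_vector_derivative_def)
qed

text \<open>Taking real parts of entries is compatible with multiplication by a real matrix, on either side.
  So the entrywise real part of the complex flow is again a flow.\<close>
lemma real_matrix_flow_exists:
  fixes C :: "real^'n^'n"
  assumes flow: "matrix_flow CARD('n) (complex_mat C) E"
    and bd: "entries_bounded CARD('n) E g"
  obtains \<Phi> K where "linear_flow (matrix_blinfun C) \<Phi>" "0 \<le> K" "\<And>t. norm (\<Phi> t) \<le> K * \<bar>g t\<bar>"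
proof -
  define \<iota> where "\<iota> = to_nat_on (UNIV :: 'n set)"
  have bij: "bij_betw \<iota> UNIV {..<CARD('n)}"
    unfolding \<iota>_def by (rule to_nat_on_finite) simp
  then have \<iota>_less: "\<iota> a < CARD('n)" for a
    by (auto simp: bij_betw_def)
  have C_index: "complex_mat C $$ (\<iota> a, \<iota> b) = of_real (vec_nth (vec_nth C a) b)" for a b
    using \<iota>_less[of a] \<iota>_less[of b]
    by (simp add: complex_mat_def) (simp add: \<iota>_def)
  have E: "E t \<in> carrier_mat CARD('n) CARD('n)" for t
    using flow by (simp add: matrix_flow_def)
  define M :: "real \<Rightarrow> real^'n^'n" where "M t = vec_lambda (\<lambda>a. vec_lambda (\<lambda>b. Re (E t $$ (\<iota> a, \<iota> b))))" for t
  have CE: "Re ((complex_mat C * E t) $$ (\<iota> a, \<iota> b)) = vec_nth (vec_nth (C ** M t) a) b" for t a b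
  proof -
    have "(complex_mat C * E t) $$ (\<iota> a, \<iota> b) =
        (\<Sum>l<CARD('n). complex_mat C $$ (\<iota> a, l) * E t $$ (l, \<iota> b))"
      by (rule index_mult_mat_sum[OF complex_mat_carrier E \<iota>_less \<iota>_less])
    also have "\<dots> = (\<Sum>c\<in>UNIV. complex_mat C $$ (\<iota> a, \<iota> c) * E t $$ (\<iota> c, \<iota> b))"
      by (rule sum.reindex_bij_betw[OF bij, symmetric])
    finally show ?thesis by (simp add: matrix_matrix_mult_def M_def C_index)
  qed
  have EC: "Re ((E t * complex_mat C) $$ (\<iota> a, \<iota> b)) = vec_nth (vec_nth (M t ** C) a) b" for t a b
  proof -
    have "(E t * complex_mat C) $$ (\<iota> a, \<iota> b) =
        (\<Sum>l<CARD('n). E t $$ (\<iota> a, l) * complex_mat C $$ (l, \<iota> b))"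
      by (rule index_mult_mat_sum[OF E complex_mat_carrier \<iota>_less \<iota>_less])
    also have "\<dots> = (\<Sum>c\<in>UNIV. E t $$ (\<iota> a, \<iota> c) * complex_mat C $$ (\<iota> c, \<iota> b))"
      by (rule sum.reindex_bij_betw[OF bij, symmetric])
    finally show ?thesis by (simp add: matrix_matrix_mult_def M_def C_index)
  qed
  have "M t ** C = C ** M t" for t
  proof -
    have "complex_mat C * E t = E t * complex_mat C" using flow by (simp add: matrix_flow_def)
    then have "vec_nth (vec_nth (M t ** C) a) b = vec_nth (vec_nth (C ** M t) a) b" for a b
      unfolding CE[symmetric] EC[symmetric] by simp
    then show ?thesis by (simp add: Finite_Cartesian_Product.vec_eq_iff)
  qed
  moreover have "(M has_vector_derivative C ** M t) (at t)" for t
  proof (rule has_vector_derivative_matrix)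
    fix a b
    have "((\<lambda>t. E t $$ (\<iota> a, \<iota> b)) has_vector_derivative (complex_mat C * E t) $$ (\<iota> a, \<iota> b)) (at t)"
      by (rule matrix_flow_deriv[OF flow \<iota>_less \<iota>_less])
    then show "((\<lambda>t. vec_nth (vec_nth (M t) a) b) has_vector_derivative
        vec_nth (vec_nth (C ** M t) a) b) (at t)"
      unfolding CE[symmetric] by (simp add: has_vector_derivative_complex_iff M_def
          has_real_derivative_iff_has_vector_derivative)
  qed
  moreover have "M 0 *v v = v" for v
  proof -
    have "E 0 = 1\<^sub>m CARD('n)" using flow by (simp add: matrix_flow_def)
    moreover have "\<iota> a = \<iota> b \<longleftrightarrow> a = b" for a b using bij by (auto simp: bij_betw_def inj_on_def)
    ultimately have "vec_nth (vec_nth (M 0) a) b = (if a = b then 1 else 0)" for a b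
      using \<iota>_less by (simp add: M_def)
    then show ?thesis by (simp add: Finite_Cartesian_Product.vec_eq_iff matrix_vector_mult_def if_distrib[of "\<lambda>x. x * _"] cong: if_cong)
  qed
  ultimately have "linear_flow (matrix_blinfun C) (\<lambda>t. matrix_blinfun (M t))"
    by unfold_locales
      (auto simp: matrix_blinfun_mult[symmetric] blinfun_eqI
        intro: bounded_linear.has_vector_derivative[OF bounded_linear_matrix_blinfun])
  moreover obtain K where K: "\<And>i j t. i < CARD('n) \<Longrightarrow> j < CARD('n) \<Longrightarrow> cmod (E t $$ (i, j)) \<le> K * g t"
    using bd by (auto simp: entries_bounded_def)
  obtain c where c: "c > 0" "\<And>M :: real^'n^'n. norm (matrix_blinfun M) \<le> norm M * c"
    using bounded_linear.pos_bounded[OF bounded_linear_matrix_blinfun[where 'n='n]] by blast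
  have "norm (matrix_blinfun (M t)) \<le> (c * (\<Sum>a\<in>(UNIV::'n set). \<Sum>b\<in>(UNIV::'n set). \<bar>K\<bar>)) * \<bar>g t\<bar>" for t
  proof -
    have entry: "\<bar>vec_nth (vec_nth (M t) a) b\<bar> \<le> \<bar>K\<bar> * \<bar>g t\<bar>" for a b
    proof -
      have "\<bar>vec_nth (vec_nth (M t) a) b\<bar> \<le> cmod (E t $$ (\<iota> a, \<iota> b))"
        by (simp add: M_def abs_Re_le_cmod)
      also have "\<dots> \<le> K * g t" by (rule K[OF \<iota>_less \<iota>_less])
      also have "\<dots> \<le> \<bar>K\<bar> * \<bar>g t\<bar>" by (metis abs_ge_self abs_mult)
      finally show ?thesis .
    qed
    have "norm (M t) \<le> (\<Sum>a\<in>UNIV. norm (vec_nth (M t) a))"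
      unfolding norm_vec_def by (rule L2_set_le_sum) simp
    also have "\<dots> \<le> (\<Sum>a\<in>UNIV. \<Sum>b\<in>UNIV. \<bar>vec_nth (vec_nth (M t) a) b\<bar>)"
      by (intro sum_mono norm_le_l1_cart)
    also have "\<dots> \<le> (\<Sum>a\<in>(UNIV::'n set). \<Sum>b\<in>(UNIV::'n set). \<bar>K\<bar> * \<bar>g t\<bar>)"
      by (intro sum_mono entry)
    finally have "norm (M t) * c \<le> (\<Sum>a\<in>(UNIV::'n set). \<Sum>b\<in>(UNIV::'n set). \<bar>K\<bar> * \<bar>g t\<bar>) * c"
      using c(1) by simp
    then show ?thesis using c(2)[of "M t"] by (simp add: mult_ac)
  qed
  moreover have "0 \<le> c * (\<Sum>a\<in>(UNIV::'n set). \<Sum>b\<in>(UNIV::'n set). \<bar>K\<bar>)"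
    using c(1) by (simp add: sum_nonneg)
  ultimately show ?thesis using that by blast
qed

proposition flow_growth_bound:
  fixes C :: "real^'n^'n"
  assumes \<alpha>: "\<alpha> = Min (eigenvalue_re_parts C)" and \<beta>: "\<beta> = Max (eigenvalue_re_parts C)"
  obtains \<Phi> K where "linear_flow (matrix_blinfun C) \<Phi>" "0 \<le> K"
    "\<And>t. norm (\<Phi> t) \<le> K * growth_rate (Max (elementary_divisor_degrees C \<beta>) - 1)
      (Max (elementary_divisor_degrees C \<alpha>) - 1) \<alpha> \<beta> t"
proof -
  obtain n_as where jnf: "jordan_nf (complex_mat C) n_as" by (rule complex_mat_jordan_nf_exists)
  have blocks: "(Re z < \<beta> \<or> (Re z = \<beta> \<and> k - 1 \<le> Max (elementary_divisor_degrees C \<beta>) - 1)) \<and>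
      (\<alpha> < Re z \<or> (Re z = \<alpha> \<and> k - 1 \<le> Max (elementary_divisor_degrees C \<alpha>) - 1))"
    if kz: "(k, z) \<in> set n_as" for k z
  proof -
    have "Re z \<in> eigenvalue_re_parts C"
      unfolding eigenvalue_re_parts_def jordan_nf_spectrum[OF complex_mat_carrier jnf]
      using kz by force
    then have "\<alpha> \<le> Re z" "Re z \<le> \<beta>"
      unfolding \<alpha> \<beta> using eigenvalue_re_parts_finite_nonempty[of C] by simp_all
    moreover have "k \<le> Max (elementary_divisor_degrees C (Re z))"
      using kz jnf by (intro Max_ge finite_elementary_divisor_degrees)
        (auto simp: elementary_divisor_degrees_def)
    ultimately show ?thesis by auto
  qed
  obtain E where "matrix_flow CARD('n) (complex_mat C) E"
    "entries_bounded CARD('n) E (growth_rate (Max (elementary_divisor_degrees C \<beta>) - 1)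
      (Max (elementary_divisor_degrees C \<alpha>) - 1) \<alpha> \<beta>)"
    using jordan_nf_flow_exists[OF complex_mat_carrier jnf blocks] by blast
  from real_matrix_flow_exists[OF this] show ?thesis
    using that growth_rate_nonneg by (metis abs_of_nonneg)
qed

section \<open>Asymptotic equivalence\<close>

lemma tail_integral_tendsto_0:
  fixes G :: "real \<Rightarrow> real"
  assumes G: "set_integrable lebesgue {a..} G"
  shows "((\<lambda>t. integral {t..} G) \<longlongrightarrow> 0) at_top"
proof -
  have abs: "G absolutely_integrable_on S" if "S \<subseteq> {a..}" "S \<in> sets lebesgue" for S
    using set_integrable_subset[OF G that(2,1)] .
  have "((\<lambda>t. set_lebesgue_integral lebesgue {a..t} G) \<longlongrightarrow> set_lebesgue_integral lebesgue {a..} G) at_top"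
    using G by (intro tendsto_set_lebesgue_integral_at_top) auto
  then have "((\<lambda>t. integral {a..t} G) \<longlongrightarrow> integral {a..} G) at_top"
    using set_lebesgue_integral_eq_integral(2)[OF abs] by simp
  then have "((\<lambda>t. integral {a..} G - integral {a..t} G) \<longlongrightarrow> integral {a..} G - integral {a..} G) at_top"
    by (intro tendsto_intros)
  moreover have "\<forall>\<^sub>F t in at_top. integral {a..} G - integral {a..t} G = integral {t..} G"
    using eventually_ge_at_top[of a]
  proof eventually_elim
    case (elim t)
    then show ?case
      using integral_atLeast_split[of G a t] set_lebesgue_integral_eq_integral(1)[OF abs] by simp
  qed
  ultimately show ?thesis
    using tendsto_cong[of "\<lambda>t. integral {a..} G - integral {a..t} G" "\<lambda>t. integral {t..} G"] by simp
qed

text \<open>The kernel of the integral equations in the norm weighted by \<open>s ^ p * exp (\<beta> * s)\<close>. Forward in time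
  (\<open>s \<le> t\<close>) the exponentials combine to \<open>exp (\<beta> * t)\<close> and \<open>1 + t - s \<le> t\<close>. Backward in time they combine to
  \<open>exp (\<beta> * t) * exp ((\<beta> - \<alpha>) * (s - t))\<close> and \<open>1 + s - t \<le> s\<close>. In both cases the factor depending on
  \<open>s\<close> is at most \<open>s ^ (p + q) * exp ((\<beta> - \<alpha>) * s)\<close>.\<close>
lemma growth_rate_weight_le:
  fixes \<alpha> \<beta> s t :: real
  assumes "1 \<le> s" "1 \<le> t" "\<alpha> \<le> \<beta>"
  shows "growth_rate p q \<alpha> \<beta> (t - s) * (s ^ p * exp (\<beta> * s))
    \<le> t ^ p * exp (\<beta> * t) * (s ^ (p + q) * exp ((\<beta> - \<alpha>) * s))"
proof (cases "s \<le> t")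
  case True
  have "growth_rate p q \<alpha> \<beta> (t - s) * (s ^ p * exp (\<beta> * s))
      = (1 + t - s) ^ p * s ^ p * (exp (\<beta> * (t - s)) * exp (\<beta> * s))"
    using True by (simp add: growth_rate_def add_diff_eq)
  also have "exp (\<beta> * (t - s)) * exp (\<beta> * s) = exp (\<beta> * t)"
    by (simp add: exp_add[symmetric] algebra_simps)
  also have "(1 + t - s) ^ p * s ^ p * exp (\<beta> * t) \<le> t ^ p * s ^ p * exp (\<beta> * t)"
    using assms True by (intro mult_right_mono power_mono) auto
  also have "\<dots> = t ^ p * exp (\<beta> * t) * (s ^ p * 1)" by simp
  also have "\<dots> \<le> t ^ p * exp (\<beta> * t) * (s ^ p * (s ^ q * exp ((\<beta> - \<alpha>) * s)))"
  proof -
    have "1 * 1 \<le> s ^ q * exp ((\<beta> - \<alpha>) * s)"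
      using assms by (intro mult_mono one_le_power) auto
    then show ?thesis using assms by (intro mult_left_mono) auto
  qed
  finally show ?thesis by (simp add: power_add mult_ac)
next
  case False
  have "growth_rate p q \<alpha> \<beta> (t - s) * (s ^ p * exp (\<beta> * s))
      = (1 + s - t) ^ q * s ^ p * (exp (\<alpha> * (t - s)) * exp (\<beta> * s))"
    using False by (simp add: growth_rate_def diff_diff_eq2)
  also have "exp (\<alpha> * (t - s)) * exp (\<beta> * s) = exp (\<beta> * t) * exp ((\<beta> - \<alpha>) * (s - t))"
    by (simp add: exp_add[symmetric] algebra_simps)
  also have "\<dots> \<le> exp (\<beta> * t) * exp ((\<beta> - \<alpha>) * s)"
    using assms by (simp add: mult_left_mono)
  also have "(1 + s - t) ^ q * s ^ p * (exp (\<beta> * t) * exp ((\<beta> - \<alpha>) * s))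
      \<le> (1 * s ^ q) * s ^ p * (exp (\<beta> * t) * exp ((\<beta> - \<alpha>) * s))"
    using assms False by (intro mult_right_mono) (auto intro!: power_mono)
  also have "\<dots> \<le> (t ^ p * s ^ q) * s ^ p * (exp (\<beta> * t) * exp ((\<beta> - \<alpha>) * s))"
    using assms by (intro mult_right_mono one_le_power) auto
  finally show ?thesis
    using assms False by (simp add: power_add mult_ac mult_left_mono)
qed

text \<open>The integrand is the integrable density times \<open>((s - u) / s) ^ q * exp (\<alpha> * u)\<close>, a bounded continuous
  factor. Without this, the integral whose limit is assumed could be 0 by convention.\<close>
lemma shifted_kernel_integrable:
  fixes \<eta> :: "real \<Rightarrow> real"
  assumes int: "set_integrable lebesgue {0..} (\<lambda>s. s ^ (p + q) * exp ((\<beta> - \<alpha>) * s) * \<eta> s)" and u: "1 \<le> u"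
  shows "set_integrable lebesgue {u..}
    (\<lambda>s. (s - u) ^ q * s ^ p * exp (\<alpha> * (u - s)) * exp (\<beta> * s) * \<eta> s)"
proof -
  have "(\<lambda>s. (((s - u) / s) ^ q * exp (\<alpha> * u)) * (s ^ (p + q) * exp ((\<beta> - \<alpha>) * s) * \<eta> s))
      absolutely_integrable_on {u..}"
  proof (rule absolutely_integrable_bounded_measurable_product_real)
    show "(\<lambda>s. ((s - u) / s) ^ q * exp (\<alpha> * u)) \<in> borel_measurable (lebesgue_on {u..})"
      using u by (intro continuous_imp_measurable_on_sets_lebesgue continuous_intros) auto
    have "norm (((s - u) / s) ^ q * exp (\<alpha> * u)) \<le> exp (\<alpha> * u)" if "s \<in> {u..}" for s
    proof -
      have "\<bar>(s - u) / s\<bar> \<le> 1" using that u by simp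
      then have "\<bar>(s - u) / s\<bar> ^ q \<le> 1" by (intro power_le_one) auto
      then have "\<bar>(s - u) / s\<bar> ^ q * exp (\<alpha> * u) \<le> 1 * exp (\<alpha> * u)" by (intro mult_right_mono) auto
      then show ?thesis by (simp add: abs_mult power_abs)
    qed
    then show "bounded ((\<lambda>s. ((s - u) / s) ^ q * exp (\<alpha> * u)) ` {u..})"
      by (auto simp: bounded_iff)
    show "(\<lambda>s. s ^ (p + q) * exp ((\<beta> - \<alpha>) * s) * \<eta> s) absolutely_integrable_on {u..}"
      by (rule set_integrable_subset[OF int]) (use u in auto)
  qed simp
  moreover have "(((s - u) / s) ^ q * exp (\<alpha> * u)) * (s ^ (p + q) * exp ((\<beta> - \<alpha>) * s) * \<eta> s) =
      (s - u) ^ q * s ^ p * exp (\<alpha> * (u - s)) * exp (\<beta> * s) * \<eta> s" if "s \<in> {u..}" for s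
  proof -
    have "(((s - u) / s) ^ q * exp (\<alpha> * u)) * (s ^ (p + q) * exp ((\<beta> - \<alpha>) * s) * \<eta> s) =
        (((s - u) / s) ^ q * s ^ (p + q)) * (exp (\<alpha> * u) * exp ((\<beta> - \<alpha>) * s)) * \<eta> s"
      by (simp only: mult_ac)
    also have "exp (\<alpha> * u) * exp ((\<beta> - \<alpha>) * s) = exp (\<alpha> * (u - s)) * exp (\<beta> * s)"
      by (simp add: exp_add[symmetric] algebra_simps)
    also have "((s - u) / s) ^ q * s ^ (p + q) = (s - u) ^ q * s ^ p"
      using that u by (simp add: power_divide power_add)
    finally show ?thesis by (simp only: mult.assoc)
  qed
  ultimately show ?thesis
    by (subst set_integrable_cong[OF refl refl, symmetric]) auto
qed

text \<open>At \<open>t = s\<close> the two branches of the growth rate agree, so the backward form covers this case.\<close>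
lemma growth_rate_nonpos_arg:
  "t \<le> s \<Longrightarrow> growth_rate p q \<alpha> \<beta> (t - s) = (1 + s - t) ^ q * exp (\<alpha> * (t - s))"
  by (cases "t = s") (auto simp: growth_rate_def diff_diff_eq2)

theorem theorem3p2:
  fixes C :: "real^'n^'n"
    and f :: "real \<Rightarrow> real^'n \<Rightarrow> real^'n"
    and \<eta> :: "real \<Rightarrow> real"
    and \<alpha> \<beta> :: real
    and m\<^sub>\<alpha> m\<^sub>\<beta> :: nat
  assumes f_cont: "continuous_on UNIV (\<lambda>(t, x). f t x)"
    and f_zero: "\<And>t. f t 0 = 0"
    and \<alpha>: "\<alpha> = Min (eigenvalue_re_parts C)"
    and \<beta>: "\<beta> = Max (eigenvalue_re_parts C)"
    and m\<^sub>\<alpha>: "m\<^sub>\<alpha> = Max (elementary_divisor_degrees C \<alpha>)"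
    and m\<^sub>\<beta>: "m\<^sub>\<beta> = Max (elementary_divisor_degrees C \<beta>)"
    and \<eta>_nonneg: "\<And>t. t \<ge> 0 \<Longrightarrow> \<eta> t \<ge> 0"
    and lipschitz: "\<And>t x1 x2. t \<ge> 0 \<Longrightarrow> norm (f t x1 - f t x2) \<le> \<eta> t * norm (x1 - x2)"
    and integrable: "set_integrable lebesgue {0..}
          (\<lambda>t. t ^ (m\<^sub>\<beta> + m\<^sub>\<alpha> - 2) * exp ((\<beta> - \<alpha>) * t) * \<eta> t)"
    and limit: "((\<lambda>t. LINT s:{t..}|lebesgue.
          (s - t) ^ (m\<^sub>\<alpha> - 1) * s ^ (m\<^sub>\<beta> - 1) * exp (\<alpha> * (t - s)) * exp (\<beta> * s) * \<eta> s)
          \<longlongrightarrow> 0) at_top"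
  shows "asymptotically_equivalent (\<lambda>t y. C *v y + f t y) (\<lambda>t x. C *v x)"
proof -
  define p where "p = m\<^sub>\<beta> - 1"
  define q where "q = m\<^sub>\<alpha> - 1"
  have "\<alpha> \<in> eigenvalue_re_parts C" "\<beta> \<in> eigenvalue_re_parts C"
    unfolding \<alpha> \<beta> using eigenvalue_re_parts_finite_nonempty[of C] by simp_all
  then have "1 \<le> m\<^sub>\<alpha>" "1 \<le> m\<^sub>\<beta>" and \<alpha>\<beta>: "\<alpha> \<le> \<beta>"
    unfolding m\<^sub>\<alpha> m\<^sub>\<beta> using eigenvalue_re_parts_finite_nonempty(1)[of C]
    by (simp_all only: Max_elementary_divisor_degrees_pos) (simp add: \<alpha>)
  then have pq: "m\<^sub>\<beta> + m\<^sub>\<alpha> - 2 = p + q" by (simp add: p_def q_def)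
  obtain \<Phi> K where flow: "linear_flow (matrix_blinfun C) \<Phi>" and K: "0 \<le> K"
    and \<Phi>_le: "\<And>t. norm (\<Phi> t) \<le> K * growth_rate p q \<alpha> \<beta> t"
    by (rule flow_growth_bound[OF \<alpha> \<beta>, folded m\<^sub>\<alpha> m\<^sub>\<beta>, folded p_def q_def])
      (rule that)
  have \<Phi>_apply_le: "norm (\<Phi> t v) \<le> K * growth_rate p q \<alpha> \<beta> t * N" if "norm v \<le> N" for t v N
  proof -
    have "norm (\<Phi> t v) \<le> norm (\<Phi> t) * norm v" by (rule norm_blinfun)
    also have "\<dots> \<le> K * growth_rate p q \<alpha> \<beta> t * N"
      using that \<Phi>_le K growth_rate_nonneg by (intro mult_mono) auto
    finally show ?thesis .
  qed

  define w where "w s = s ^ p * exp (\<beta> * s)" for s :: real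
  define \<theta> where "\<theta> s = K * (s ^ (p + q) * exp ((\<beta> - \<alpha>) * s) * \<eta> s)" for s
  define J where "J u s = (s - u) ^ q * s ^ p * exp (\<alpha> * (u - s)) * exp (\<beta> * s) * \<eta> s" for u s
  define \<kappa> where "\<kappa> t s = K * exp \<alpha> * J (t - 1) s" for t s

  have \<theta>_abs: "set_integrable lebesgue {0..} \<theta>"
    unfolding \<theta>_def using integrable by (simp add: pq)
  from tail_integral_tendsto_0[OF this] have "\<forall>\<^sub>F t in at_top. integral {t..} \<theta> < 1 / 2"
    by (rule order_tendstoD) simp
  then have "\<forall>\<^sub>F t in at_top. integral {t..} \<theta> < 1 / 2 \<and> 1 \<le> t"
    using eventually_ge_at_top by (rule eventually_conj)
  then obtain t0 where t0: "1 \<le> t0" "integral {t0..} \<theta> \<le> 1 / 2"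
    unfolding eventually_at_top_linorder by (meson less_imp_le order_refl)

  have J_abs: "J u absolutely_integrable_on {u..}" if "1 \<le> u" for u
    unfolding J_def[abs_def] using integrable that unfolding pq by (rule shifted_kernel_integrable)
  have J_int: "J u integrable_on {u..}" "J u integrable_on {u + 1..}" if "1 \<le> u" for u
    using set_integrable_subset[OF J_abs[OF that], of "{u + 1..}"] J_abs[OF that]
    by (auto intro: set_lebesgue_integral_eq_integral(1))
  have J_nonneg: "0 \<le> J u s" if "1 \<le> u" "u \<le> s" for u s
    using that \<eta>_nonneg by (simp add: J_def)
  have J_lim: "((\<lambda>u. integral {u..} (J u)) \<longlongrightarrow> 0) at_top"
  proof -
    have "\<forall>\<^sub>F u in at_top. (LINT s:{u..}|lebesgue. J u s) = integral {u..} (J u)"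
      using eventually_ge_at_top[of 1]
      by eventually_elim (rule set_lebesgue_integral_eq_integral(2)[OF J_abs])
    then show ?thesis
      using limit unfolding p_def[symmetric] q_def[symmetric] J_def[symmetric]
      by (rule Lim_transform_eventually[rotated])
  qed

  \<comment> \<open>\<open>J u\<close> vanishes at \<open>s = u\<close> if \<open>q > 0\<close>, whereas the flow does not. Basing the kernel at \<open>t - 1\<close>
     turns the factor \<open>(1 + s - t) ^ q\<close> of the flow into \<open>(s - u) ^ q\<close>, at the cost of \<open>exp \<alpha>\<close>.\<close>
  interpret perturbed_flow "matrix_blinfun C" \<Phi> f \<eta> w \<theta> \<kappa> "K * exp (- \<beta> * t0)" t0
  proof (intro perturbed_flow.intro flow perturbed_flow_axioms.intro)
    show "continuous_on UNIV (\<lambda>(t, x). f t x)" "\<And>t. f t 0 = 0" by fact+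
    show "norm (f t x1 - f t x2) \<le> \<eta> t * norm (x1 - x2)" if "t0 \<le> t" for t x1 x2
      using that t0 by (intro lipschitz) simp
    show "0 \<le> \<eta> t" if "t0 \<le> t" for t using that t0 \<eta>_nonneg by simp
    show "0 < w t" if "t0 \<le> t" for t using that t0 by (simp add: w_def)
    show "continuous_on {t0..} w" unfolding w_def[abs_def] by (intro continuous_intros)
    show "0 \<le> K * exp (- \<beta> * t0)" using K by simp
    show "norm (\<Phi> (t - t0) v) \<le> K * exp (- \<beta> * t0) * w t * norm v" if t: "t0 \<le> t" for t v
    proof -
      have "growth_rate p q \<alpha> \<beta> (t - t0) = (1 + t - t0) ^ p * exp (\<beta> * (t - t0))"
        using t by (simp add: growth_rate_def add_diff_eq)
      also have "\<dots> \<le> t ^ p * exp (\<beta> * (t - t0))"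
        using t t0 by (intro mult_right_mono power_mono) auto
      also have "\<dots> = exp (- \<beta> * t0) * w t"
        by (simp add: w_def exp_add[symmetric] algebra_simps)
      finally have "K * growth_rate p q \<alpha> \<beta> (t - t0) * norm v \<le> K * (exp (- \<beta> * t0) * w t) * norm v"
        using K by (intro mult_right_mono mult_left_mono) auto
      then show ?thesis using \<Phi>_apply_le[of v "norm v" "t - t0"] by (simp add: mult.assoc)
    qed
    show "\<theta> integrable_on {t0..}"
      by (rule set_lebesgue_integral_eq_integral(1)[OF set_integrable_subset[OF \<theta>_abs]]) (use t0 in auto)
    show "0 \<le> \<theta> s" if "t0 \<le> s" for s using that t0 K \<eta>_nonneg by (simp add: \<theta>_def)
    show "integral {t0..} \<theta> \<le> 1 / 2" by (rule t0(2))
    show "norm (\<Phi> (t - s) v) \<le> M * w t * \<theta> s"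
      if st: "t0 \<le> s" "t0 \<le> t" and M: "0 \<le> M" and v: "norm v \<le> \<eta> s * (M * w s)" for s t M v
    proof -
      have "norm (\<Phi> (t - s) v) \<le> K * growth_rate p q \<alpha> \<beta> (t - s) * (\<eta> s * (M * w s))"
        using v by (rule \<Phi>_apply_le)
      also have "\<dots> = (K * M * \<eta> s) * (growth_rate p q \<alpha> \<beta> (t - s) * w s)" by simp
      also have "\<dots> \<le> (K * M * \<eta> s) * (w t * (s ^ (p + q) * exp ((\<beta> - \<alpha>) * s)))"
        using growth_rate_weight_le[of s t \<alpha> \<beta> p q] st t0 M K \<alpha>\<beta> \<eta>_nonneg[of s]
        unfolding w_def by (intro mult_left_mono) auto
      finally show ?thesis by (simp add: \<theta>_def mult_ac)
    qed
    show "\<kappa> t integrable_on {t..}" if "t0 + 1 \<le> t" for t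
      unfolding \<kappa>_def[abs_def] using J_int(2)[of "t - 1"] that t0 by (intro integrable_on_mult_right) simp
    show "norm (\<Phi> (t - s) v) \<le> M * \<kappa> t s"
      if st: "t0 + 1 \<le> t" "t \<le> s" and M: "0 \<le> M" and v: "norm v \<le> \<eta> s * (M * w s)" for s t M v
    proof -
      have "norm (\<Phi> (t - s) v) \<le> K * growth_rate p q \<alpha> \<beta> (t - s) * (\<eta> s * (M * w s))"
        using v by (rule \<Phi>_apply_le)
      also have "\<dots> = M * K * ((s - (t - 1)) ^ q * s ^ p * exp (\<alpha> * (t - s)) * exp (\<beta> * s) * \<eta> s)"
        using growth_rate_nonpos_arg[OF st(2), of p q \<alpha> \<beta>] by (simp add: w_def algebra_simps)
      also have "exp (\<alpha> * (t - s)) = exp \<alpha> * exp (\<alpha> * (t - 1 - s))"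
        by (simp add: exp_add[symmetric] algebra_simps)
      finally show ?thesis by (simp add: \<kappa>_def J_def mult_ac)
    qed
    show "((\<lambda>t. integral {t..} (\<kappa> t)) \<longlongrightarrow> 0) at_top"
    proof (rule tendsto_0_le)
      show "((\<lambda>t. integral {t - 1..} (J (t - 1))) \<longlongrightarrow> 0) at_top"
      proof (rule filterlim_compose[OF J_lim])
        show "filterlim (\<lambda>t::real. t - 1) at_top at_top"
          unfolding filterlim_at_top
        proof
          fix Z :: real
          show "\<forall>\<^sub>F t in at_top. Z \<le> t - 1"
            using eventually_ge_at_top[of "Z + 1"] by eventually_elim simp
        qed
      qed
      have "norm (integral {t..} (\<kappa> t)) \<le> norm (integral {t - 1..} (J (t - 1))) * (K * exp \<alpha>)"
        if t: "2 \<le> t" for t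
      proof -
        have "0 \<le> integral {t..} (J (t - 1))"
          using J_int(2)[of "t - 1"] t by (intro Henstock_Kurzweil_Integration.integral_nonneg) (auto intro!: J_nonneg)
        moreover have "integral {t..} (J (t - 1)) \<le> integral {t - 1..} (J (t - 1))"
          using J_int[of "t - 1"] t by (intro integral_subset_le) (auto intro!: J_nonneg)
        ultimately show ?thesis
          using K by (simp add: \<kappa>_def[abs_def] abs_mult mult.commute mult_left_mono)
      qed
      then show "\<forall>\<^sub>F t in at_top. norm (integral {t..} (\<kappa> t))
          \<le> norm (integral {t - 1..} (J (t - 1))) * (K * exp \<alpha>)"
        by (auto simp: eventually_at_top_linorder)
    qed
  qed
  show ?thesis
    using asymptotically_equivalent_perturbation t0 by simp
qed

end
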